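(* Let $p\in(0,1)$ and $\alpha\in(0,1)$ be fixed, let $q=1-p$, let $z_{\alpha/2}$ be the upper $\alpha/2$ quantile of the standard normal distribution, and let $X\sim \mathrm{Bin}(n,p)$. Let $L_{CP}=p_U-p_L$ be the length of the two-sided $1-\alpha$ Clopper--Pearson interval $(p_L,p_U)$ based on $X$. Then, as $n\to\infty$, $$E(L_{CP})=2z_{\alpha/2}n^{-1/2}(pq)^{1/2}+n^{-1}+n^{-3/2}(pq)^{-1/2}\frac{z_{\alpha/2}}{18}\Big(z_{\alpha/2}^2-\frac{5}{2}-17pq-13pqz_{\alpha/2}^2\Big)+O(n^{-2}).$$
   Context: The two-sided $1-\alpha$ Clopper--Pearson interval for a binomial proportion based on an observation $X$ from $n$ trials is $(p_L,p_U)$, where for $X\in\{1,\dots,n-1\}$, $p_L$ is the solution of $\sum_{k=X}^n\binom{n}{k}p_L^k(1-p_L)^{n-k}=\alpha/2$ and $p_U$ is the solution of $\sum_{k=0}^{X}\binom{n}{k}p_U^k(1-p_U)^{n-k}=\alpha/2$; equivalently $p_L=B(\alpha/2,X,n-X+1)$ and $p_U=B(1-\alpha/2,X+1,n-X)$, where $B(\gamma,a,b)$ is the $\gamma$-quantile of the $Beta(a,b)$ distribution. For $X=0$ the interval is $(0,1-(\alpha/2)^{1/n})$ and for $X=n$ it is $((\alpha/2)^{1/n},1)$. *)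

theory Defs
  imports "HOL-Probability.Probability" "HOL-Library.Landau_Symbols"
begin

definition std_normal_upper_quantile :: "real \<Rightarrow> real" where
  "std_normal_upper_quantile \<gamma> =
     (THE z. measure std_normal_distribution {z<..} = \<gamma>)"

text \<open>
  Endpoints of the two-sided Clopper--Pearson interval with confidence level \<open>1 - \<alpha>\<close>, for
  an observation \<open>x\<close> from \<open>n\<close> trials. For \<open>1 \<le> x \<le> n - 1\<close> each defining equation has exactly
  one root in the parameter space \<open>[0, 1]\<close>; the restriction to \<open>[0, 1]\<close> is needed because the
  polynomials may have further real roots outside. The values are meaningful for \<open>n \<ge> 1\<close> and
  \<open>x \<le> n\<close>.
\<close>

definition cp_lower :: "nat \<Rightarrow> real \<Rightarrow> nat \<Rightarrow> real" where
  "cp_lower n \<alpha> x =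
     (if x = 0 then 0
      else if x = n then (\<alpha> / 2) powr (1 / real n)
      else (THE p. 0 \<le> p \<and> p \<le> 1 \<and>
              (\<Sum>k=x..n. real (n choose k) * p ^ k * (1 - p) ^ (n - k)) = \<alpha> / 2))"

definition cp_upper :: "nat \<Rightarrow> real \<Rightarrow> nat \<Rightarrow> real" where
  "cp_upper n \<alpha> x =
     (if x = 0 then 1 - (\<alpha> / 2) powr (1 / real n)
      else if x = n then 1
      else (THE p. 0 \<le> p \<and> p \<le> 1 \<and>
              (\<Sum>k=0..x. real (n choose k) * p ^ k * (1 - p) ^ (n - k)) = \<alpha> / 2))"

definition cp_length :: "nat \<Rightarrow> real \<Rightarrow> nat \<Rightarrow> real" where
  "cp_length n \<alpha> x = cp_upper n \<alpha> x - cp_lower n \<alpha> x"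

end

theory Submission
  imports Defs "HOL-Real_Asymp.Real_Asymp"
begin

text \<open>
  The upper endpoint is a quantile of a beta distribution, whose distribution function
  \<open>u \<mapsto> P(Bin(n, u) > x)\<close> has an explicit derivative. Substitute \<open>u = T(w)\<close>, where \<open>T\<close> is the
  Cornish--Fisher polynomial in \<open>w\<close> to order \<open>n powr (- 3 / 2)\<close>: for \<open>\<bar>w\<bar> \<le> ln n\<close> and uniformly for \<open>x / n\<close>
  away from 0 and 1, the density becomes a constant multiple of the standard normal density up to a
  relative error \<open>O(n powr (- 3 / 2))\<close> times a polynomial in \<open>w\<close>. Hoeffding's inequality disposes of the tails and
  thereby fixes the constant, so that \<open>P(Bin(n, T(w)) > x) = \<Phi>(w) + O(n powr (- 3 / 2))\<close> and the endpoint is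
  \<open>T(z) + O(1 / n\<^sup>2)\<close>. The lower endpoint follows by the symmetry \<open>x \<mapsto> n - x\<close>. The resulting expansion of
  the length in \<open>x / n\<close> is Taylor expanded around \<open>p\<close> with an error bounded by \<open>1 / n\<^sup>2 + (x / n - p)\<^sup>4\<close>; for
  \<open>x / n\<close> near 0 or 1 this bound is trivial. Taking expectations needs only the second and fourth
  central moments of the binomial distribution.
\<close>

section \<open>The normal distribution function\<close>

text \<open>The accuracy needed is set by the last inversion. Write d for n powr (- 1 / 2). Near z
  the slope of \<open>Phi\<close> is bounded below, while the slope of T is of order d, so an error
  of order d^3 in probability becomes one of order d^4 in the endpoint. A relative error of order
  d^3 in the density asks for the log density up to order d^2. The log likelihood carries the factor
  n = 1 / d^2, which is why its logarithms are expanded to fourth order and the remaining ones only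
  to second order. The obstacle is uniformity: no constant may depend on x or w, although w ranges
  over a window that grows with n. The remainder is therefore kept as an exact algebraic expression,
  bounded by a polynomial in \<bar>w\<bar> with uniform constants; the Gaussian factor then absorbs
  that polynomial.\<close>

definition Phi :: "real \<Rightarrow> real" where
  "Phi w = measure std_normal_distribution {..w}"

lemma prob_space_std_normal: "prob_space std_normal_distribution"
  using real_dist_normal_dist real_distribution.axioms(1) by blast

lemma Phi_nonneg: "0 \<le> Phi w" and Phi_le_1: "Phi w \<le> 1"
  by (auto simp: Phi_def prob_space.prob_le_1[OF prob_space_std_normal])

lemma Phi_diff_eq_integral:
  assumes "a \<le> b"
  shows "Phi b - Phi a = integral {a..b} std_normal_density"
proof -
  interpret prob_space std_normal_distribution by (rule prob_space_std_normal)
  have *: "set_integrable lborel {a..b} std_normal_density"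
    unfolding set_integrable_def by (rule integrable_mult_indicator) auto
  have "Phi b - Phi a = measure std_normal_distribution ({..b} - {..a})"
    unfolding Phi_def by (subst finite_measure_Diff) (use assms in auto)
  also have "{..b} - {..a} = {a<..b}" by auto
  also have "measure std_normal_distribution {a<..b}
      = (\<integral>x. indicator {a<..b} x * std_normal_density x \<partial>lborel)"
    by (subst measure_def, subst emeasure_density)
       (auto simp: integral_eq_nn_integral ennreal_mult'' ennreal_indicator mult.commute
             intro!: arg_cong[where f = enn2real] nn_integral_cong)
  also have "\<dots> = (\<integral>x. indicator {a..b} x * std_normal_density x \<partial>lborel)"
    by (intro integral_cong_AE) (auto intro!: AE_I[where N="{a}"] simp: indicator_def)
  also have "\<dots> = integral {a..b} std_normal_density"
    using set_borel_integral_eq_integral(2)[OF *]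
    by (simp add: set_lebesgue_integral_def)
  finally show ?thesis .
qed

lemma continuous_on_std_normal_density: "continuous_on A std_normal_density"
  by (auto simp: std_normal_density_def intro!: continuous_intros)

lemma has_real_derivative_Phi: "(Phi has_real_derivative std_normal_density w) (at w)"
proof -
  have "((\<lambda>u. integral {w - 1..u} std_normal_density) has_real_derivative std_normal_density w)
      (at w within {w - 1..w + 1})"
    by (rule integral_has_real_derivative) (auto intro: continuous_on_std_normal_density)
  hence "((\<lambda>u. Phi (w - 1) + integral {w - 1..u} std_normal_density)
      has_real_derivative std_normal_density w) (at w within {w - 1..w + 1})"
    by (auto intro!: derivative_eq_intros)
  hence "(Phi has_real_derivative std_normal_density w) (at w within {w - 1..w + 1})"
    by (rule has_field_derivative_transform_within[where d = 1])
       (auto simp: Phi_diff_eq_integral[symmetric])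
  thus ?thesis
    by (subst (asm) at_within_Icc_at) auto
qed

lemma Phi_at_bot: "(Phi \<longlongrightarrow> 0) at_bot" and Phi_at_top: "(Phi \<longlongrightarrow> 1) at_top"
proof -
  interpret real_distribution std_normal_distribution by (rule real_dist_normal_dist)
  have *: "Phi = cdf std_normal_distribution" by (auto simp: Phi_def cdf_def)
  show "(Phi \<longlongrightarrow> 0) at_bot" "(Phi \<longlongrightarrow> 1) at_top"
    unfolding * by (rule cdf_lim_at_bot cdf_lim_at_top_prob)+
qed

lemma strict_mono_Phi: "strict_mono Phi"
proof (rule strict_monoI)
  fix x y :: real assume "x < y"
  thus "Phi x < Phi y"
    by (rule DERIV_pos_imp_increasing) (use has_real_derivative_Phi normal_density_pos[of 1] in force)
qed

lemma std_normal_upper_quantile: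
  assumes "0 < \<gamma>" "\<gamma> < 1"
  shows "Phi (std_normal_upper_quantile \<gamma>) = 1 - \<gamma>"
proof -
  interpret prob_space std_normal_distribution by (rule prob_space_std_normal)
  have eq: "measure std_normal_distribution {w<..} = 1 - Phi w" for w
    using prob_compl[of "{..w}"] by (simp add: Phi_def Compl_eq_Diff_UNIV[symmetric] del: Compl_eq_Diff_UNIV)
  have "\<forall>\<^sub>F x in at_bot. Phi x < 1 - \<gamma>" "\<forall>\<^sub>F x in at_top. Phi x > 1 - \<gamma>"
    using assms by (auto intro!: order_tendstoD[OF Phi_at_bot] order_tendstoD[OF Phi_at_top])
  then obtain a b where ab: "Phi a < 1 - \<gamma>" "Phi b > 1 - \<gamma>"
    by (metis eventually_at_bot_linorder eventually_at_top_linorder order_refl)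
  hence "a \<le> b" using strict_mono_less[OF strict_mono_Phi, of a b] by linarith
  hence "\<exists>w. a \<le> w \<and> w \<le> b \<and> Phi w = 1 - \<gamma>"
    using ab by (intro IVT) (auto intro: DERIV_isCont has_real_derivative_Phi)
  then obtain w where w: "Phi w = 1 - \<gamma>" by blast
  have "std_normal_upper_quantile \<gamma> = w"
    unfolding std_normal_upper_quantile_def eq
    using w strict_mono_eq[OF strict_mono_Phi] by (intro the_equality) auto
  thus ?thesis using w by simp
qed

text \<open>\<open>C * exp (3 * w) - Phi w\<close> is nondecreasing and vanishes at minus infinity,
  and the upper tail is treated in the mirrored way. The rate 3 makes the mass beyond
  \<open>ln n\<close> of order n powr (- 3), well below the permitted n powr (- 3 / 2).\<close>

lemma Phi_tail:
  obtains C :: real where "C > 0" "\<And>w. Phi w \<le> C * exp (3 * w)" "\<And>w. 1 - Phi w \<le> C * exp (- 3 * w)"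
proof -
  \<comment> \<open>Expanding (x + 3)^2 \<ge> 0 and (x - 3)^2 \<ge> 0 gives the factor exp (9/2);
    the division by 3 compensates the derivative of \<open>exp (3 * x)\<close>.\<close>
  define C :: real where "C = exp (9/2) / 3"
  have b: "std_normal_density x \<le> 3 * (C * exp (3 * x))" "std_normal_density x \<le> 3 * (C * exp (- 3 * x))" for x
  proof -
    have "sqrt (2 * pi) \<ge> 1" using pi_gt3 by simp
    hence "1 / sqrt (2 * pi) \<le> 1" by simp
    hence *: "std_normal_density x \<le> 1 * exp (- x\<^sup>2 / 2)"
      unfolding std_normal_density_def by (intro mult_right_mono) auto
    have "- x\<^sup>2 / 2 \<le> 9/2 + 3 * x" "- x\<^sup>2 / 2 \<le> 9/2 + - 3 * x"
      using zero_le_power2[of "x + 3"] zero_le_power2[of "x - 3"]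
      by (auto simp: power2_eq_square algebra_simps)
    hence **: "exp (- x\<^sup>2 / 2) \<le> exp (9/2 + 3 * x)" "exp (- x\<^sup>2 / 2) \<le> exp (9/2 + - 3 * x)"
      unfolding exp_le_cancel_iff .
    have ***: "3 * (C * exp y) = exp (9/2 + y)" for y
      by (simp add: C_def exp_add)
    show "std_normal_density x \<le> 3 * (C * exp (3 * x))"
        "std_normal_density x \<le> 3 * (C * exp (- 3 * x))"
      unfolding *** using * ** by linarith+
  qed
  have "C > 0" by (simp add: C_def)
  moreover have "Phi w \<le> C * exp (3 * w)" for w
  proof -
    have "0 \<le> C * exp (3 * w) - Phi w"
    proof (rule tendsto_upperbound)
      show "((\<lambda>x. C * exp (3 * x) - Phi x) \<longlongrightarrow> 0) at_bot"
        by (rule tendsto_eq_rhs[OF tendsto_diff[OF _ Phi_at_bot]]) (real_asymp, simp)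
      show "\<forall>\<^sub>F x in at_bot. C * exp (3 * x) - Phi x \<le> C * exp (3 * w) - Phi w"
        using eventually_le_at_bot[of w]
      proof eventually_elim
        case (elim x)
        show ?case
        proof (rule DERIV_nonneg_imp_nondecreasing[OF elim])
          fix y show "\<exists>D. ((\<lambda>x. C * exp (3 * x) - Phi x) has_real_derivative D) (at y) \<and> 0 \<le> D"
            using b(1)[of y]
            by (intro exI[of _ "3 * (C * exp (3 * y)) - std_normal_density y"])
               (auto intro!: derivative_eq_intros has_real_derivative_Phi)
        qed
      qed
    qed auto
    thus ?thesis by simp
  qed
  moreover have "1 - Phi w \<le> C * exp (- 3 * w)" for w
  proof -
    have "0 \<le> C * exp (- 3 * w) - (1 - Phi w)"
    proof (rule tendsto_upperbound)
      show "((\<lambda>x. C * exp (- 3 * x) - (1 - Phi x)) \<longlongrightarrow> 0) at_top"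
        by (rule tendsto_eq_rhs[OF tendsto_diff[OF _ tendsto_diff[OF tendsto_const Phi_at_top]]]) (real_asymp, simp)
      show "\<forall>\<^sub>F x in at_top. C * exp (- 3 * x) - (1 - Phi x) \<le> C * exp (- 3 * w) - (1 - Phi w)"
        using eventually_ge_at_top[of w]
      proof eventually_elim
        case (elim x)
        show ?case
        proof (rule DERIV_nonpos_imp_nonincreasing[OF elim])
          fix y show "\<exists>D. ((\<lambda>x. C * exp (- 3 * x) - (1 - Phi x)) has_real_derivative D) (at y) \<and> D \<le> 0"
            using b(2)[of y]
            by (intro exI[of _ "- 3 * (C * exp (- 3 * y)) + std_normal_density y"])
               (auto intro!: derivative_eq_intros has_real_derivative_Phi)
        qed
      qed
    qed auto
    thus ?thesis by simp
  qed
  ultimately show ?thesis by (rule that)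
qed

section \<open>Binomial tails and the Clopper--Pearson endpoints\<close>

definition binom_cdf :: "nat \<Rightarrow> nat \<Rightarrow> real \<Rightarrow> real" where
  "binom_cdf n x u = (\<Sum>k=0..x. real (n choose k) * u ^ k * (1 - u) ^ (n - k))"

text \<open>For \<open>x < n\<close> this is the density of the Beta(x + 1, n - x) distribution;
  \<open>real (n - x) * real (n choose x)\<close> is the reciprocal of the beta function at (x + 1,
  n - x).\<close>

definition binom_cdf_slope :: "nat \<Rightarrow> nat \<Rightarrow> real \<Rightarrow> real" where
  "binom_cdf_slope n x u = real (n - x) * real (n choose x) * u ^ x * (1 - u) ^ (n - x - 1)"

text \<open>The derivatives of the summands telescope: the identity (x + 1) * (n choose (x + 1)) =
  (n - x) * (n choose x) cancels the old slope against half of the derivative of the new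
  summand.\<close>

lemma has_real_derivative_binom_cdf:
  "x < n \<Longrightarrow> (binom_cdf n x has_real_derivative - binom_cdf_slope n x u) (at u)"
proof (induction x)
  case 0
  show ?case unfolding binom_cdf_def binom_cdf_slope_def
    by (auto intro!: derivative_eq_intros)
next
  case (Suc x)
  define m where "m = n - x - 2"
  have n: "n = m + x + 2" using Suc.prems by (simp add: m_def)
  have "Suc x * (n choose Suc x) = (n - x) * (n choose x)"
    using binomial_absorb_comp[of n x] binomial_absorption[of x n]
    by (metis Suc_diff_Suc Suc_lessD Suc.prems binomial_absorb_comp binomial_absorption diff_Suc_1 mult.commute times_binomial_minus1_eq zero_less_Suc)
  hence "real (Suc x) * real (n choose Suc x) = real (n - x) * real (n choose x)"
    by (metis of_nat_mult)
  hence eq: "(1 + real x) * real (n choose Suc x) = (real m + 2) * real (n choose x)"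
    by (simp add: n)
  have "(binom_cdf n x has_real_derivative - binom_cdf_slope n x u) (at u)"
    using Suc by simp
  moreover have d1: "((\<lambda>u. u ^ Suc x) has_real_derivative real (Suc x) * u ^ x) (at u)"
    using DERIV_pow[of "Suc x" u] by simp
  have d2: "((\<lambda>u. (1 - u) ^ (n - Suc x)) has_real_derivative
      - (real (n - Suc x) * (1 - u) ^ (n - Suc x - 1))) (at u)"
    by (auto intro!: derivative_eq_intros)
  ultimately have "((\<lambda>u. binom_cdf n x u + real (n choose Suc x) * u ^ Suc x * (1 - u) ^ (n - Suc x))
      has_real_derivative - binom_cdf_slope n x u +
        real (n choose Suc x) * (real (Suc x) * u ^ x * (1 - u) ^ (n - Suc x)
          - u ^ Suc x * (real (n - Suc x) * (1 - u) ^ (n - Suc x - 1)))) (at u)"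
    by (intro DERIV_add DERIV_cong[OF DERIV_mult[OF DERIV_cmult[OF d1] d2]]) (auto simp: algebra_simps)
  moreover have "- binom_cdf_slope n x u +
        real (n choose Suc x) * (real (Suc x) * u ^ x * (1 - u) ^ (n - Suc x)
          - u ^ Suc x * (real (n - Suc x) * (1 - u) ^ (n - Suc x - 1))) = - binom_cdf_slope n (Suc x) u
        + ((1 + real x) * real (n choose Suc x) - (real m + 2) * real (n choose x)) * (u ^ x * (1 - u) ^ (m + 1))"
    unfolding binom_cdf_slope_def by (simp add: n algebra_simps)
  moreover have "(\<lambda>u. binom_cdf n x u + real (n choose Suc x) * u ^ Suc x * (1 - u) ^ (n - Suc x))
      = binom_cdf n (Suc x)"
    by (auto simp: binom_cdf_def)
  ultimately show ?case by (simp add: eq)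
qed

lemma binom_cdf_0 [simp]: "binom_cdf n x 0 = 1"
proof -
  have "binom_cdf n x 0 = (\<Sum>k=0..x. if k = 0 then 1 else 0)"
    unfolding binom_cdf_def by (intro sum.cong) auto
  thus ?thesis by simp
qed

lemma binom_cdf_1: "x < n \<Longrightarrow> binom_cdf n x 1 = 0"
  unfolding binom_cdf_def by (intro sum.neutral) auto

text \<open>The slope can vanish at 0 and at 1, so its sign is used in the open interval only and
  continuity carries the conclusion to the ends.\<close>

lemma binom_cdf_strict_antimono:
  assumes "x < n" "0 \<le> u" "u < v" "v \<le> 1"
  shows "binom_cdf n x v < binom_cdf n x u"
proof (rule DERIV_neg_imp_decreasing_open[OF \<open>u < v\<close>])
  fix t assume "u < t" "t < v"
  hence "0 < binom_cdf_slope n x t"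
    using assms unfolding binom_cdf_slope_def by (intro mult_pos_pos) auto
  thus "\<exists>D. (binom_cdf n x has_real_derivative D) (at t) \<and> D < 0"
    using has_real_derivative_binom_cdf[OF assms(1)] by force
next
  show "continuous_on {u..v} (binom_cdf n x)"
    using DERIV_isCont[OF has_real_derivative_binom_cdf[OF assms(1)]]
    by (simp add: continuous_at_imp_continuous_on)
qed

text \<open>The separately defined value at \<open>x = 0\<close> solves the same equation, which
  there reads (1 - u)^n = \<alpha> / 2. Hence all \<open>x < n\<close> can be treated alike from
  here on. At \<open>x = n\<close> the distribution function is constantly 1 and there is no
  root.\<close>

lemma cp_upper_root:
  assumes "x < n" "0 < \<alpha>" "\<alpha> < 1"
  shows "0 \<le> cp_upper n \<alpha> x" "cp_upper n \<alpha> x \<le> 1" "binom_cdf n x (cp_upper n \<alpha> x) = \<alpha> / 2"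
proof -
  have "0 \<le> cp_upper n \<alpha> x \<and> cp_upper n \<alpha> x \<le> 1 \<and> binom_cdf n x (cp_upper n \<alpha> x) = \<alpha> / 2"
  proof (cases "x = 0")
    case True
    have "(\<alpha> / 2) powr (1 / real n) \<le> 1 powr (1 / real n)"
      using assms by (intro powr_mono2) auto
    moreover have "((\<alpha> / 2) powr (1 / real n)) ^ n = \<alpha> / 2"
      using assms by (simp add: powr_powr flip: powr_realpow)
    ultimately show ?thesis
      using True by (simp add: cp_upper_def binom_cdf_def)
  next
    case False
    have "\<exists>u. 0 \<le> u \<and> u \<le> 1 \<and> binom_cdf n x u = \<alpha> / 2"
      using assms by (intro IVT2) (auto simp: binom_cdf_1 intro: DERIV_isCont has_real_derivative_binom_cdf)
    then obtain u where u: "0 \<le> u" "u \<le> 1" "binom_cdf n x u = \<alpha> / 2" by blast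
    have "cp_upper n \<alpha> x = (THE p. 0 \<le> p \<and> p \<le> 1 \<and> binom_cdf n x p = \<alpha> / 2)"
      using assms False by (simp add: cp_upper_def binom_cdf_def)
    also have "\<dots> = u"
    proof (rule the_equality)
      fix v assume "0 \<le> v \<and> v \<le> 1 \<and> binom_cdf n x v = \<alpha> / 2"
      thus "v = u"
        using u binom_cdf_strict_antimono[OF assms(1), of u v] binom_cdf_strict_antimono[OF assms(1), of v u]
        by (cases u v rule: linorder_cases) auto
    qed (use u in auto)
    finally show ?thesis using u by simp
  qed
  thus "0 \<le> cp_upper n \<alpha> x" "cp_upper n \<alpha> x \<le> 1" "binom_cdf n x (cp_upper n \<alpha> x) = \<alpha> / 2"
    by auto
qed

text \<open>Together with its counterpart for lower bounds, this is how the endpoint is located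
  later: by antitonicity, a one-sided bound on the distribution function at a trial point bounds the
  endpoint.\<close>

lemma cp_upper_le:
  assumes "x < n" "0 < \<alpha>" "\<alpha> < 1" "0 \<le> u" "binom_cdf n x u \<le> \<alpha> / 2"
  shows "cp_upper n \<alpha> x \<le> u"
  using binom_cdf_strict_antimono[OF assms(1), of u "cp_upper n \<alpha> x"] cp_upper_root[OF assms(1-3)] assms(4,5)
  by force

lemma cp_upper_ge:
  assumes "x < n" "0 < \<alpha>" "\<alpha> < 1" "u \<le> 1" "\<alpha> / 2 \<le> binom_cdf n x u"
  shows "u \<le> cp_upper n \<alpha> x"
  using binom_cdf_strict_antimono[OF assms(1), of "cp_upper n \<alpha> x" u] cp_upper_root[OF assms(1-3)] assms(4,5)
  by force

lemma cp_upper_bounds: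
  assumes "x \<le> n" "0 < n" "0 < \<alpha>" "\<alpha> < 1"
  shows "0 \<le> cp_upper n \<alpha> x" "cp_upper n \<alpha> x \<le> 1"
  using cp_upper_root[of x n \<alpha>] assms by (cases "x = n"; force simp: cp_upper_def)+

text \<open>Exchanging successes and failures sends k to n - k and p to 1 - p, which turns the upper
  tail sum into a distribution function; the two boundary cases agree by definition.\<close>

lemma cp_lower_eq_cp_upper:
  assumes "x \<le> n" "0 < n" "0 < \<alpha>" "\<alpha> < 1"
  shows "cp_lower n \<alpha> x = 1 - cp_upper n \<alpha> (n - x)"
proof -
  consider "x = 0" | "x = n" | "0 < x" "x < n" using assms by linarith
  thus ?thesis
  proof cases
    case 3
    have sum_eq: "(\<Sum>k=x..n. real (n choose k) * p ^ k * (1 - p) ^ (n - k)) = binom_cdf n (n - x) (1 - p)" for p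
      unfolding binom_cdf_def
    proof (rule sum.reindex_bij_witness[of _ "\<lambda>k. n - k" "\<lambda>k. n - k"])
      fix k assume "k \<in> {x..n}"
      thus "real (n choose (n - k)) * (1 - p) ^ (n - k) * (1 - (1 - p)) ^ (n - (n - k))
          = real (n choose k) * p ^ k * (1 - p) ^ (n - k)"
        by (simp add: binomial_symmetric[of k n])
    qed (use assms in auto)
    have lt: "n - x < n" using 3 by simp
    note root = cp_upper_root[OF lt assms(3,4)]
    have "cp_lower n \<alpha> x = (THE p. 0 \<le> p \<and> p \<le> 1 \<and> binom_cdf n (n - x) (1 - p) = \<alpha> / 2)"
      using 3 by (simp add: cp_lower_def sum_eq)
    also have "\<dots> = 1 - cp_upper n \<alpha> (n - x)"
    proof (rule the_equality)
      fix v assume v: "0 \<le> v \<and> v \<le> 1 \<and> binom_cdf n (n - x) (1 - v) = \<alpha> / 2"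
      thus "v = 1 - cp_upper n \<alpha> (n - x)"
        using cp_upper_le[OF lt assms(3,4), of "1 - v"] cp_upper_ge[OF lt assms(3,4), of "1 - v"]
        by simp
    qed (use root in auto)
    finally show ?thesis .
  qed (use assms in \<open>auto simp: cp_lower_def cp_upper_def\<close>)
qed

section \<open>Hoeffding bounds for the binomial distribution function\<close>

lemma prob_binomial_atMost:
  assumes "0 \<le> u" "u \<le> 1"
  shows "measure_pmf.prob (binomial_pmf n u) {..x} = binom_cdf n x u"
  using assms by (simp add: measure_measure_pmf_finite binom_cdf_def atLeast0AtMost)

text \<open>Hoeffding's inequality with deviation \<open>u - x / n\<close>: the event that the
  sample proportion lies that far below its mean is exactly \<open>{..x}\<close>.\<close>

lemma binom_cdf_le_exp:
  assumes "0 < n" "real x / real n \<le> u" "u \<le> 1"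
  shows "binom_cdf n x u \<le> exp (- 2 * real n * (u - real x / real n)\<^sup>2)"
proof -
  have u: "0 \<le> u" by (rule order_trans[OF _ assms(2)]) auto
  interpret binomial_distribution n u by unfold_locales (use u assms in auto)
  have "{k. real k / real n \<le> u - (u - real x / real n)} = {..x}"
    using assms by (auto simp: divide_le_cancel)
  thus ?thesis
    using prob_le'[of "u - real x / real n"] assms u prob_binomial_atMost[OF u assms(3)] by simp
qed

lemma one_minus_binom_cdf_le_exp:
  assumes "0 < n" "u \<le> real x / real n" "0 \<le> u" "u \<le> 1"
  shows "1 - binom_cdf n x u \<le> exp (- 2 * real n * (real x / real n - u)\<^sup>2)"
proof -
  interpret binomial_distribution n u by unfold_locales (use assms in auto)
  have "1 - binom_cdf n x u = measure_pmf.prob (binomial_pmf n u) {x<..}"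
    using measure_pmf.prob_compl[of "{..x}" "binomial_pmf n u"] prob_binomial_atMost[OF assms(3,4)]
    by (simp add: Compl_eq_Diff_UNIV[symmetric] del: Compl_eq_Diff_UNIV)
  also have "\<dots> \<le> measure_pmf.prob (binomial_pmf n u) {k. real k / real n \<ge> u + (real x / real n - u)}"
    by (intro measure_pmf.finite_measure_mono) (use assms in \<open>auto simp: divide_le_cancel\<close>)
  also have "\<dots> \<le> exp (- 2 * real n * (real x / real n - u)\<^sup>2)"
    using prob_ge'[of "real x / real n - u"] assms by simp
  finally show ?thesis .
qed

section \<open>Expansion of the log density\<close>

text \<open>The derivative of the error is the remainder of a geometric series, (- t)^m / (1 + t).
  The factor 2 comes from 1 + t \<ge> 1/2, and the mean value inequality supplies one more power of
  y.\<close>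

lemma ln_taylor_bound:
  fixes y :: real
  assumes "\<bar>y\<bar> \<le> 1 / 2"
  shows "\<bar>ln (1 + y) - (\<Sum>k<m. (-1) ^ k * y ^ Suc k / real (Suc k))\<bar> \<le> 2 * \<bar>y\<bar> ^ Suc m"
proof -
  define f where "f = (\<lambda>y::real. ln (1 + y) - (\<Sum>k<m. (-1) ^ k * y ^ Suc k / real (Suc k)))"
  define f' where "f' = (\<lambda>t::real. inverse (1 + t) - (\<Sum>k<m. (- t) ^ k))"
  have abs: "\<bar>t\<bar> \<le> 1/2" if "t \<in> closed_segment 0 y" for t
    using that assms by (auto simp: closed_segment_eq_real_ivl split: if_splits)
  have pow: "((\<lambda>y. (-1) ^ k * y ^ Suc k / real (Suc k)) has_real_derivative (- t) ^ k) (at t within S)" for k t S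
  proof -
    have "((\<lambda>y. (-1) ^ k * y ^ Suc k / real (Suc k)) has_real_derivative
        (-1) ^ k * (real (Suc k) * t ^ (Suc k - Suc 0)) / real (Suc k)) (at t within S)"
      by (intro DERIV_cdivide DERIV_cmult DERIV_subset[OF DERIV_pow]) auto
    moreover have "(-1) ^ k * (real (Suc k) * t ^ (Suc k - Suc 0)) / real (Suc k) = (- t) ^ k"
      by (simp add: power_minus[of t])
    ultimately show ?thesis by simp
  qed
  have deriv: "(f has_real_derivative f' t) (at t within closed_segment 0 y)"
    if "t \<in> closed_segment 0 y" for t
  proof -
    have "1 + t > 0" using abs[OF that] by auto
    thus ?thesis unfolding f_def f'_def
      by (intro DERIV_diff DERIV_sum pow) (auto intro!: derivative_eq_intros simp: divide_inverse)
  qed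
  have f'_bound: "\<bar>f' t\<bar> \<le> 2 * \<bar>y\<bar> ^ m" if "t \<in> closed_segment 0 y" for t
  proof -
    have pos: "1 + t \<ge> 1 / 2" using abs[OF that] by auto
    have "(1 + t) * (\<Sum>k<m. (- t) ^ k) = 1 - (- t) ^ m"
      using one_diff_power_eq[of "- t" m] by simp
    hence "f' t = (- t) ^ m / (1 + t)"
      using pos unfolding f'_def by (simp add: field_simps)
    hence "\<bar>f' t\<bar> = \<bar>t\<bar> ^ m / (1 + t)"
      using pos by (simp add: power_abs[symmetric])
    also have "\<dots> \<le> \<bar>y\<bar> ^ m / (1 / 2)"
      using pos that by (intro frac_le power_mono) (auto simp: closed_segment_eq_real_ivl split: if_splits)
    finally show ?thesis by simp
  qed
  have "norm (f y - f 0) \<le> 2 * \<bar>y\<bar> ^ m * norm (y - 0)"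
    by (rule field_differentiable_bound[of "closed_segment 0 y" f f'])
       (use deriv f'_bound in auto)
  thus ?thesis by (simp add: f_def mult_ac)
qed

text \<open>At \<open>y = 0\<close> the quotient is \<open>0 / 0 = 0\<close>, so the expansion below needs no case distinction.\<close>

definition ln_rem :: "nat \<Rightarrow> real \<Rightarrow> real" where
  "ln_rem m y = (ln (1 + y) - (\<Sum>k<m. (-1) ^ k * y ^ Suc k / real (Suc k))) / y ^ Suc m"

lemma ln_eq_ln_rem:
  "ln (1 + y) = (\<Sum>k<m. (-1) ^ k * y ^ Suc k / real (Suc k)) + ln_rem m y * y ^ Suc m"
  by (cases "y = 0") (auto simp: ln_rem_def)

lemma abs_ln_rem_le: "\<bar>y\<bar> \<le> 1 / 2 \<Longrightarrow> \<bar>ln_rem m y\<bar> \<le> 2"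
  using ln_taylor_bound[of y m]
  by (cases "y = 0") (auto simp: ln_rem_def abs_mult power_abs divide_le_eq)

text \<open>
  For a sample proportion \<open>P = x / n\<close> and \<open>d = 1 / sqrt n\<close>, the approximate quantile is \<open>P + d * cf_dev d P w\<close>.
  Its polynomial coefficients are the unique ones for which the logarithm of the density of \<open>w\<close>, the
  pullback of the beta density, has no terms in \<open>w\<close> of order \<open>d\<close> and \<open>d\<^sup>2\<close> beyond \<open>- w\<^sup>2 / 2\<close>.
\<close>

definition cfA :: "real \<Rightarrow> real" where "cfA P = (2 - P) / 3"
definition cfB :: "real \<Rightarrow> real" where "cfB P = (1 - 2 * P) / 3"
definition cfb :: "real \<Rightarrow> real" where "cfb P = (1 - 13 * P * (1 - P)) / 36"
definition cfa :: "real \<Rightarrow> real" where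
  "cfa P = 2 * cfA P * cfB P + cfB P * P + P\<^sup>2 / 2 + 3 * cfb P - 2 * (cfB P)\<^sup>2"
definition cf1 :: "real \<Rightarrow> real \<Rightarrow> real" where "cf1 P w = cfA P + cfB P * w\<^sup>2"
definition cf2 :: "real \<Rightarrow> real \<Rightarrow> real" where
  "cf2 P w = (cfa P * w + cfb P * w ^ 3) / sqrt (P * (1 - P))"
definition cf_dev :: "real \<Rightarrow> real \<Rightarrow> real \<Rightarrow> real" where
  "cf_dev d P w = sqrt (P * (1 - P)) * w + d * cf1 P w + d\<^sup>2 * cf2 P w"
definition cf_dev' :: "real \<Rightarrow> real \<Rightarrow> real \<Rightarrow> real" where
  "cf_dev' d P w = sqrt (P * (1 - P)) + d * (2 * cfB P * w)
     + d\<^sup>2 * ((cfa P + 3 * cfb P * w\<^sup>2) / sqrt (P * (1 - P)))"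
definition cf_const :: "real \<Rightarrow> real" where
  "cf_const P = (- (cfA P)\<^sup>2 / 2 + cfA P * P + cfa P) / (P * (1 - P))"

text \<open>
  The log density of \<open>w\<close> plus \<open>w\<^sup>2 / 2\<close>, up to a constant that does not depend on \<open>w\<close>; \<open>n = 1 / d\<^sup>2\<close> is the
  number of trials.
\<close>

definition log_density_err :: "real \<Rightarrow> real \<Rightarrow> real \<Rightarrow> real" where
  "log_density_err d P w =
     (P * ln (1 + d * (cf_dev d P w / P)) + (1 - P) * ln (1 + d * (- cf_dev d P w / (1 - P)))) / d\<^sup>2
     - ln (1 + d * (- cf_dev d P w / (1 - P)))
     + ln (1 + d * ((2 * cfB P * w) / sqrt (P * (1 - P)) + d * ((cfa P + 3 * cfb P * w\<^sup>2) / (P * (1 - P)))))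
     + w\<^sup>2 / 2 - d\<^sup>2 * cf_const P"

text \<open>Everything of order d^3 and higher in \<open>log_density_err\<close>, with d^3 divided
  out. No division by d is left, so each piece can be bounded separately. \<open>ln_rem 4\<close>
  stems from the logarithms that are divided by d^2, \<open>ln_rem 2\<close> from the other
  two.\<close>

definition log_density_rem :: "real \<Rightarrow> real \<Rightarrow> real \<Rightarrow> real" where
  "log_density_rem d P w =
    (let s = sqrt (P * (1 - P)); Q = 1 - P; c1 = cf1 P w; c2 = cf2 P w; V = cf_dev d P w; X = c1 + d * c2;
         Y1 = (2 * cfB P * w) / s; Y2 = (cfa P + 3 * cfb P * w\<^sup>2) / (P * (1 - P)); Y = Y1 + d * Y2
     in - (2 * c1 * c2 + d * c2\<^sup>2) / (2 * s\<^sup>2)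
        + (3 * s\<^sup>2 * w\<^sup>2 * c2 + 3 * s * w * X\<^sup>2 + d * X ^ 3) * (Q - P) / (3 * s ^ 4)
        - (4 * s ^ 3 * w ^ 3 * X + d * 6 * s\<^sup>2 * w\<^sup>2 * X\<^sup>2 + d\<^sup>2 * 4 * s * w * X ^ 3 + d ^ 3 * X ^ 4)
            * (1 - 3 * s\<^sup>2) / (4 * s ^ 6)
        + V ^ 5 * (ln_rem 4 (d * (V / P)) / P ^ 4 - ln_rem 4 (d * (- V / Q)) / Q ^ 4)
        + c2 / Q + (2 * s * w * X + d * X\<^sup>2) / (2 * Q\<^sup>2) + V ^ 3 * ln_rem 2 (d * (- V / Q)) / Q ^ 3
        - (2 * Y1 * Y2 + d * Y2\<^sup>2) / 2 + ln_rem 2 (d * Y) * Y ^ 3)"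

lemma ln_ln_rem_2: "ln (1 + y) = y - y\<^sup>2 / 2 + ln_rem 2 y * y ^ 3" for y :: real
  using ln_eq_ln_rem[of y 2] by (simp add: eval_nat_numeral)

lemma ln_ln_rem_4: "ln (1 + y) = y - y\<^sup>2 / 2 + y ^ 3 / 3 - y ^ 4 / 4 + ln_rem 4 y * y ^ 5" for y :: real
  using ln_eq_ln_rem[of y 4] by (simp add: eval_nat_numeral)

text \<open>An exact identity, since \<open>ln_rem\<close> absorbs the Taylor errors. Order 0
  cancels against w^2 / 2; orders 1 and 2 vanish by the choice of the coefficients, as computed in
  \<open>p1\<close> and \<open>p2\<close>.\<close>

lemma log_density_err_eq:
  assumes P: "0 < P" "P < 1" and d: "d \<noteq> 0"
  shows "log_density_err d P w = d ^ 3 * log_density_rem d P w"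
proof -
  define s where "s = sqrt (P * (1 - P))"
  define Q where "Q = 1 - P"
  define V where "V = cf_dev d P w"
  define c1 where "c1 = cf1 P w"
  define c2 where "c2 = cf2 P w"
  define X where "X = c1 + d * c2"
  define Y1 where "Y1 = (2 * cfB P * w) / s"
  define Y2 where "Y2 = (cfa P + 3 * cfb P * w\<^sup>2) / (P * Q)"
  define Y where "Y = Y1 + d * Y2"
  define r1 where "r1 = ln_rem 4 (d * (V / P))"
  define r2 where "r2 = ln_rem 4 (d * (- V / Q))"
  define r3 where "r3 = ln_rem 2 (d * (- V / Q))"
  define r4 where "r4 = ln_rem 2 (d * Y)"
  have s: "s > 0" and s2: "s\<^sup>2 = P * Q" and Q: "Q > 0" and PQ: "P + Q = 1"
    using P by (auto simp: s_def Q_def)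
  have V: "V = s * w + d * X"
    by (simp add: V_def cf_dev_def X_def c1_def c2_def s_def power2_eq_square algebra_simps)
  \<comment> \<open>The linear terms \<open>d * V\<close> and \<open>- d * V\<close> cancel, so the
    division by d^2 leaves nothing singular; after it the fifth-order remainders have order
    d^3.\<close>
  have t1: "(P * ln (1 + d * (V / P)) + Q * ln (1 + d * (- V / Q))) / d\<^sup>2 =
      - (V\<^sup>2) * (1 / P + 1 / Q) / 2 + d * V ^ 3 * (1 / P\<^sup>2 - 1 / Q\<^sup>2) / 3
      - d\<^sup>2 * V ^ 4 * (1 / P ^ 3 + 1 / Q ^ 3) / 4 + d ^ 3 * V ^ 5 * (r1 / P ^ 4 - r2 / Q ^ 4)"
  proof -
    have "P * ln (1 + d * (V / P)) = d * V - d\<^sup>2 * (V\<^sup>2 / P / 2) + d\<^sup>2 * (d * V ^ 3 / P\<^sup>2 / 3)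
        - d\<^sup>2 * (d\<^sup>2 * V ^ 4 / P ^ 3 / 4) + d\<^sup>2 * (d ^ 3 * V ^ 5 * r1 / P ^ 4)"
      using P by (subst ln_ln_rem_4) (simp add: r1_def field_simps power2_eq_square eval_nat_numeral)
    moreover have "Q * ln (1 + d * (- V / Q)) = - d * V - d\<^sup>2 * (V\<^sup>2 / Q / 2) - d\<^sup>2 * (d * V ^ 3 / Q\<^sup>2 / 3)
        - d\<^sup>2 * (d\<^sup>2 * V ^ 4 / Q ^ 3 / 4) - d\<^sup>2 * (d ^ 3 * V ^ 5 * r2 / Q ^ 4)"
      using Q by (subst ln_ln_rem_4) (simp add: r2_def field_simps power2_eq_square eval_nat_numeral)
    ultimately have "P * ln (1 + d * (V / P)) + Q * ln (1 + d * (- V / Q)) =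
       d\<^sup>2 * (- (V\<^sup>2) * (1 / P + 1 / Q) / 2 + d * V ^ 3 * (1 / P\<^sup>2 - 1 / Q\<^sup>2) / 3
      - d\<^sup>2 * V ^ 4 * (1 / P ^ 3 + 1 / Q ^ 3) / 4 + d ^ 3 * V ^ 5 * (r1 / P ^ 4 - r2 / Q ^ 4))"
      by (simp add: algebra_simps add_divide_distrib diff_divide_distrib)
    thus ?thesis using d by simp
  qed
  have e1: "1 / P + 1 / Q = 1 / s\<^sup>2"
    using P Q PQ by (simp add: s2 field_simps)
  have e2: "1 / P\<^sup>2 - 1 / Q\<^sup>2 = (Q - P) / s ^ 4"
  proof -
    have "s ^ 4 = (P * Q)\<^sup>2" using s2 by (metis power2_eq_square power4_eq_xxxx mult.assoc)
    moreover have "(Q - P) = (Q - P) * (P + Q)" using PQ by simp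
    ultimately show ?thesis
      using P Q by (simp add: field_simps power2_eq_square)
  qed
  have e3: "1 / P ^ 3 + 1 / Q ^ 3 = (1 - 3 * s\<^sup>2) / s ^ 6"
  proof -
    have "s ^ 6 = (P * Q) ^ 3" by (simp add: s2[symmetric] flip: power_mult)
    moreover have "1 - 3 * s\<^sup>2 = P ^ 3 + Q ^ 3"
      unfolding s2 Q_def by (simp add: algebra_simps power2_eq_square power3_eq_cube)
    ultimately show ?thesis
      using P Q by (simp add: field_simps)
  qed
  have t2: "- ln (1 + d * (- V / Q)) = d * V / Q + d\<^sup>2 * V\<^sup>2 / (2 * Q\<^sup>2) + d ^ 3 * (V ^ 3 * r3 / Q ^ 3)"
    using Q by (subst ln_ln_rem_2) (simp add: r3_def field_simps power2_eq_square eval_nat_numeral)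
  have t3: "ln (1 + d * Y) = d * Y1 + d\<^sup>2 * Y2 - d\<^sup>2 * (Y1\<^sup>2 / 2) - d ^ 3 * ((2 * Y1 * Y2 + d * Y2\<^sup>2) / 2)
      + d ^ 3 * (r4 * Y ^ 3)"
    by (subst ln_ln_rem_2) (simp add: r4_def Y_def field_simps power2_eq_square eval_nat_numeral)
  \<comment> \<open>The whole coefficient of d. Its w^3 part forces
    \<open>cfB P = (Q - P) / 3\<close>, and its w part then forces
    \<open>cfA P = P + 2 * cfB P\<close>.\<close>
  have p1: "- w * c1 / s + w ^ 3 * (Q - P) / (3 * s) + s * w / Q + Y1 = 0"
  proof -
    have *: "s * w / Q = w * P / s" using s Q s2 by (simp add: field_simps power2_eq_square)
    have "- w * c1 / s + w ^ 3 * (Q - P) / (3 * s) + s * w / Q + Y1 =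
        (- w * c1 + w ^ 3 * (Q - P) / 3 + w * P + 2 * cfB P * w) / s"
      unfolding * using s by (simp add: Y1_def add_divide_distrib diff_divide_distrib)
    also have "- w * c1 + w ^ 3 * (Q - P) / 3 + w * P + 2 * cfB P * w = 0"
      by (simp add: c1_def cf1_def cfA_def cfB_def Q_def field_simps power2_eq_square power3_eq_cube)
    finally show ?thesis by simp
  qed
  \<comment> \<open>The whole coefficient of d^2 before the constant is subtracted. Its w^4 part
    determines \<open>cfb\<close>, its w^2 part determines \<open>cfa\<close>, and what is free of w
    is \<open>cf_const\<close>.\<close>
  have p2: "- (2 * s * w * c2 + c1\<^sup>2) / (2 * s\<^sup>2) + (Q - P) * w\<^sup>2 * c1 / s\<^sup>2 - w ^ 4 * (1 - 3 * s\<^sup>2) / (4 * s\<^sup>2)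
       + c1 / Q + s\<^sup>2 * w\<^sup>2 / (2 * Q\<^sup>2) + Y2 - Y1\<^sup>2 / 2 = cf_const P"
  proof -
    have "s * c2 = cfa P * w + cfb P * w ^ 3" using s by (simp add: c2_def cf2_def flip: s_def)
    hence E1: "2 * s * w * c2 = 2 * w * (cfa P * w + cfb P * w ^ 3)" by (simp add: mult_ac)
    have E2: "c1 / Q = c1 * P / s\<^sup>2" "s\<^sup>2 * w\<^sup>2 / (2 * Q\<^sup>2) = (w\<^sup>2 * P\<^sup>2 / 2) / s\<^sup>2"
      unfolding s2 using P Q by (simp_all add: power2_eq_square field_simps)
    have E3: "Y1\<^sup>2 = (2 * cfB P * w)\<^sup>2 / s\<^sup>2" by (simp add: Y1_def power_divide)
    have "- (2 * s * w * c2 + c1\<^sup>2) / (2 * s\<^sup>2) + (Q - P) * w\<^sup>2 * c1 / s\<^sup>2 - w ^ 4 * (1 - 3 * s\<^sup>2) / (4 * s\<^sup>2)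
       + c1 / Q + s\<^sup>2 * w\<^sup>2 / (2 * Q\<^sup>2) + Y2 - Y1\<^sup>2 / 2 =
       (- (2 * w * (cfa P * w + cfb P * w ^ 3) + c1\<^sup>2) / 2 + (Q - P) * w\<^sup>2 * c1 - w ^ 4 * (1 - 3 * (P * Q)) / 4
        + c1 * P + w\<^sup>2 * P\<^sup>2 / 2 + (cfa P + 3 * cfb P * w\<^sup>2) - (2 * cfB P * w)\<^sup>2 / 2) / (P * Q)"
      unfolding E1 E2 E3 Y2_def unfolding s2
      by (simp add: add_divide_distrib diff_divide_distrib mult.commute[of 2] mult.commute[of 4])
    also have "- (2 * w * (cfa P * w + cfb P * w ^ 3) + c1\<^sup>2) / 2 + (Q - P) * w\<^sup>2 * c1 - w ^ 4 * (1 - 3 * (P * Q)) / 4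
        + c1 * P + w\<^sup>2 * P\<^sup>2 / 2 + (cfa P + 3 * cfb P * w\<^sup>2) - (2 * cfB P * w)\<^sup>2 / 2 =
        - (cfA P)\<^sup>2 / 2 + cfA P * P + cfa P"
      by (simp add: c1_def cf1_def cfa_def cfA_def cfB_def cfb_def Q_def field_simps eval_nat_numeral)
    finally show ?thesis by (simp add: cf_const_def Q_def)
  qed
  \<comment> \<open>Each power of V is expanded only as far as its prefactor requires: V^2 occurs
    with factor 1, V^3 with d and V^4 with d^2. The coarser \<open>V2'\<close> serves the occurrence
    of V^2 with factor d^2 that comes from \<open>t2\<close>.\<close>
  have V2: "V\<^sup>2 = s\<^sup>2 * w\<^sup>2 + d * (2 * s * w * c1) + d\<^sup>2 * (2 * s * w * c2 + c1\<^sup>2) + d ^ 3 * (2 * c1 * c2 + d * c2\<^sup>2)"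
    unfolding V X_def by algebra
  have V2': "V\<^sup>2 = s\<^sup>2 * w\<^sup>2 + d * (2 * s * w * X + d * X\<^sup>2)"
    unfolding V by algebra
  have V3: "V ^ 3 = s ^ 3 * w ^ 3 + d * (3 * s\<^sup>2 * w\<^sup>2 * c1) + d\<^sup>2 * (3 * s\<^sup>2 * w\<^sup>2 * c2 + 3 * s * w * X\<^sup>2 + d * X ^ 3)"
    unfolding V X_def by algebra
  have V4: "V ^ 4 = s ^ 4 * w ^ 4 + d * (4 * s ^ 3 * w ^ 3 * X + d * 6 * s\<^sup>2 * w\<^sup>2 * X\<^sup>2 + d\<^sup>2 * 4 * s * w * X ^ 3 + d ^ 3 * X ^ 4)"
    unfolding V by algebra
  have "log_density_err d P w =
     (P * ln (1 + d * (V / P)) + Q * ln (1 + d * (- V / Q))) / d\<^sup>2 - ln (1 + d * (- V / Q))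
     + ln (1 + d * Y) + w\<^sup>2 / 2 - d\<^sup>2 * cf_const P"
    by (simp add: log_density_err_def V_def Q_def Y_def Y1_def Y2_def s_def)
  also have "\<dots> = - (V\<^sup>2 / (2 * s\<^sup>2)) + d * (V ^ 3 * (Q - P) / (3 * s ^ 4))
      - d\<^sup>2 * (V ^ 4 * (1 - 3 * s\<^sup>2) / (4 * s ^ 6)) + d ^ 3 * (V ^ 5 * (r1 / P ^ 4 - r2 / Q ^ 4))
      + d * V / Q + d\<^sup>2 * (V\<^sup>2 / (2 * Q\<^sup>2)) + d ^ 3 * (V ^ 3 * r3 / Q ^ 3)
      + (d * Y1 + d\<^sup>2 * Y2 - d\<^sup>2 * (Y1\<^sup>2 / 2) - d ^ 3 * ((2 * Y1 * Y2 + d * Y2\<^sup>2) / 2)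
      + d ^ 3 * (r4 * Y ^ 3)) + w\<^sup>2 / 2 - d\<^sup>2 * cf_const P"
    unfolding t1 t3 e1 e2 e3 using t2 by simp
  also have "V\<^sup>2 / (2 * s\<^sup>2) = w\<^sup>2 / 2 + d * (w * c1 / s) + d\<^sup>2 * ((2 * s * w * c2 + c1\<^sup>2) / (2 * s\<^sup>2))
      + d ^ 3 * ((2 * c1 * c2 + d * c2\<^sup>2) / (2 * s\<^sup>2))"
    unfolding V2 using s by (simp add: divide_simps) (simp add: algebra_simps eval_nat_numeral)
  also have "V ^ 3 * (Q - P) / (3 * s ^ 4) = w ^ 3 * (Q - P) / (3 * s) + d * ((Q - P) * w\<^sup>2 * c1 / s\<^sup>2)
      + d\<^sup>2 * ((3 * s\<^sup>2 * w\<^sup>2 * c2 + 3 * s * w * X\<^sup>2 + d * X ^ 3) * (Q - P) / (3 * s ^ 4))"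
    unfolding V3 using s by (simp add: divide_simps) (simp add: algebra_simps eval_nat_numeral)
  also have "V ^ 4 * (1 - 3 * s\<^sup>2) / (4 * s ^ 6) = w ^ 4 * (1 - 3 * s\<^sup>2) / (4 * s\<^sup>2) +
      d * ((4 * s ^ 3 * w ^ 3 * X + d * 6 * s\<^sup>2 * w\<^sup>2 * X\<^sup>2 + d\<^sup>2 * 4 * s * w * X ^ 3 + d ^ 3 * X ^ 4)
            * (1 - 3 * s\<^sup>2) / (4 * s ^ 6))"
    unfolding V4 using s by (simp add: divide_simps) (simp add: algebra_simps eval_nat_numeral)
  also have "V\<^sup>2 / (2 * Q\<^sup>2) = s\<^sup>2 * w\<^sup>2 / (2 * Q\<^sup>2) + d * ((2 * s * w * X + d * X\<^sup>2) / (2 * Q\<^sup>2))"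
    unfolding V2' by (simp only: add_divide_distrib[of "s\<^sup>2 * w\<^sup>2"] times_divide_eq_right)
  also have "d * V / Q = d * (s * w / Q) + d\<^sup>2 * (c1 / Q) + d ^ 3 * (c2 / Q)"
    unfolding V X_def by (simp add: add_divide_distrib algebra_simps eval_nat_numeral)
  finally have "log_density_err d P w = d * (- w * c1 / s + w ^ 3 * (Q - P) / (3 * s) + s * w / Q + Y1)
    + d\<^sup>2 * (- (2 * s * w * c2 + c1\<^sup>2) / (2 * s\<^sup>2) + (Q - P) * w\<^sup>2 * c1 / s\<^sup>2 - w ^ 4 * (1 - 3 * s\<^sup>2) / (4 * s\<^sup>2)
       + c1 / Q + s\<^sup>2 * w\<^sup>2 / (2 * Q\<^sup>2) + Y2 - Y1\<^sup>2 / 2 - cf_const P)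
    + d ^ 3 * (- (2 * c1 * c2 + d * c2\<^sup>2) / (2 * s\<^sup>2)
        + (3 * s\<^sup>2 * w\<^sup>2 * c2 + 3 * s * w * X\<^sup>2 + d * X ^ 3) * (Q - P) / (3 * s ^ 4)
        - (4 * s ^ 3 * w ^ 3 * X + d * 6 * s\<^sup>2 * w\<^sup>2 * X\<^sup>2 + d\<^sup>2 * 4 * s * w * X ^ 3 + d ^ 3 * X ^ 4)
            * (1 - 3 * s\<^sup>2) / (4 * s ^ 6)
        + V ^ 5 * (r1 / P ^ 4 - r2 / Q ^ 4)
        + c2 / Q + (2 * s * w * X + d * X\<^sup>2) / (2 * Q\<^sup>2) + V ^ 3 * r3 / Q ^ 3
        - (2 * Y1 * Y2 + d * Y2\<^sup>2) / 2 + r4 * Y ^ 3)"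
    by (simp only: minus_divide_left[symmetric] power2_eq_square power3_eq_cube) (simp only: algebra_simps)
  also have "\<dots> = d ^ 3 * log_density_rem d P w"
    unfolding p1 p2 by (simp add: log_density_rem_def Let_def s_def Q_def V_def c1_def c2_def
      X_def Y1_def Y2_def Y_def r1_def r2_def r3_def r4_def)
  finally show ?thesis .
qed

section \<open>Uniform remainder estimates\<close>

text \<open>Abstracts a regime in which P stays away from 0 and 1 and d beats every power of 1 +
  \<bar>W\<bar>. Working along a filter lets one argument deliver constants that are uniform in all
  parameters.\<close>

locale uniform_expansion =
  fixes F :: "'a filter" and d W P :: "'a \<Rightarrow> real" and e :: real
  assumes e_pos: "0 < e"
    and P_bounds: "\<forall>\<^sub>F t in F. e \<le> P t \<and> P t \<le> 1 - e"
    and d_pos: "\<forall>\<^sub>F t in F. 0 < d t"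
    and small: "\<And>k. ((\<lambda>t. d t * (1 + \<bar>W t\<bar>) ^ k) \<longlongrightarrow> 0) F"
begin

text \<open>At most polynomial growth in W. Boundedness would be too strong, since W itself may be
  unbounded; this class contains W and is closed under all operations that build
  \<open>log_density_rem\<close>.\<close>

definition tame :: "('a \<Rightarrow> real) \<Rightarrow> bool" where
  "tame f \<longleftrightarrow> (\<exists>C k. \<forall>\<^sub>F t in F. \<bar>f t\<bar> \<le> C * (1 + \<bar>W t\<bar>) ^ k)"

lemma tame_bounded: "\<forall>\<^sub>F t in F. \<bar>f t\<bar> \<le> C \<Longrightarrow> tame f"
  unfolding tame_def by (rule exI[of _ C], rule exI[of _ 0]) simp

lemma tame_const: "tame (\<lambda>_. c)"
  by (rule tame_bounded[of _ "\<bar>c\<bar>"]) simp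

lemma tame_W: "tame W"
  unfolding tame_def by (rule exI[of _ 1], rule exI[of _ 1]) simp

lemma tame_nonneg_const:
  assumes "tame f"
  obtains C k where "C > 0" "\<forall>\<^sub>F t in F. \<bar>f t\<bar> \<le> C * (1 + \<bar>W t\<bar>) ^ k"
proof -
  from assms obtain C k where C: "\<forall>\<^sub>F t in F. \<bar>f t\<bar> \<le> C * (1 + \<bar>W t\<bar>) ^ k"
    unfolding tame_def by blast
  have "C * y ^ k \<le> (\<bar>C\<bar> + 1) * y ^ k" if "y \<ge> 0" for y :: real
    using that by (intro mult_right_mono) auto
  with C have "\<forall>\<^sub>F t in F. \<bar>f t\<bar> \<le> (\<bar>C\<bar> + 1) * (1 + \<bar>W t\<bar>) ^ k"
    by (auto elim!: eventually_mono intro: order_trans)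
  thus ?thesis by (intro that[of "\<bar>C\<bar> + 1" k]) auto
qed

lemma tame_mult:
  assumes "tame f" "tame g"
  shows "tame (\<lambda>t. f t * g t)"
proof -
  obtain C k where C: "C > 0" "\<forall>\<^sub>F t in F. \<bar>f t\<bar> \<le> C * (1 + \<bar>W t\<bar>) ^ k"
    using tame_nonneg_const[OF assms(1)] .
  obtain D l where D: "D > 0" "\<forall>\<^sub>F t in F. \<bar>g t\<bar> \<le> D * (1 + \<bar>W t\<bar>) ^ l"
    using tame_nonneg_const[OF assms(2)] .
  have "\<forall>\<^sub>F t in F. \<bar>f t * g t\<bar> \<le> (C * D) * (1 + \<bar>W t\<bar>) ^ (k + l)"
    using C(2) D(2)
  proof eventually_elim
    case (elim t)
    hence "\<bar>f t\<bar> * \<bar>g t\<bar> \<le> (C * (1 + \<bar>W t\<bar>) ^ k) * (D * (1 + \<bar>W t\<bar>) ^ l)"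
      by (intro mult_mono) auto
    thus ?case by (simp add: abs_mult power_add mult_ac)
  qed
  thus ?thesis unfolding tame_def by blast
qed

lemma tame_add:
  assumes "tame f" "tame g"
  shows "tame (\<lambda>t. f t + g t)"
proof -
  obtain C k where C: "C > 0" "\<forall>\<^sub>F t in F. \<bar>f t\<bar> \<le> C * (1 + \<bar>W t\<bar>) ^ k"
    using tame_nonneg_const[OF assms(1)] .
  obtain D l where D: "D > 0" "\<forall>\<^sub>F t in F. \<bar>g t\<bar> \<le> D * (1 + \<bar>W t\<bar>) ^ l"
    using tame_nonneg_const[OF assms(2)] .
  have "\<forall>\<^sub>F t in F. \<bar>f t + g t\<bar> \<le> (C + D) * (1 + \<bar>W t\<bar>) ^ max k l"
    using C(2) D(2)
  proof eventually_elim
    case (elim t)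
    have "C * (1 + \<bar>W t\<bar>) ^ k \<le> C * (1 + \<bar>W t\<bar>) ^ max k l" "D * (1 + \<bar>W t\<bar>) ^ l \<le> D * (1 + \<bar>W t\<bar>) ^ max k l"
      using C D by (auto intro!: power_increasing)
    with elim show ?case unfolding distrib_right by linarith
  qed
  thus ?thesis unfolding tame_def by blast
qed

lemma tame_uminus: "tame f \<Longrightarrow> tame (\<lambda>t. - f t)"
  unfolding tame_def by simp

lemma tame_diff: "tame f \<Longrightarrow> tame g \<Longrightarrow> tame (\<lambda>t. f t - g t)"
  using tame_add[OF _ tame_uminus, of f g] by simp

lemma tame_power: "tame f \<Longrightarrow> tame (\<lambda>t. f t ^ k)"
  by (induction k) (auto intro: tame_const tame_mult)

lemma d_tendsto_0: "(d \<longlongrightarrow> 0) F"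
  using small[of 0] by simp

lemma tame_d: "tame d"
proof (rule tame_bounded)
  have "\<forall>\<^sub>F t in F. d t < 1" using order_tendstoD(2)[OF d_tendsto_0] by simp
  thus "\<forall>\<^sub>F t in F. \<bar>d t\<bar> \<le> 1" using d_pos by eventually_elim auto
qed

lemma d_mult_tame_tendsto_0:
  assumes "tame f"
  shows "((\<lambda>t. d t * f t) \<longlongrightarrow> 0) F"
proof -
  obtain C k where C: "C > 0" "\<forall>\<^sub>F t in F. \<bar>f t\<bar> \<le> C * (1 + \<bar>W t\<bar>) ^ k"
    using tame_nonneg_const[OF assms] .
  have "((\<lambda>t. C * (d t * (1 + \<bar>W t\<bar>) ^ k)) \<longlongrightarrow> 0) F"
    using tendsto_mult_left[OF small, of C] by simp
  moreover have "\<forall>\<^sub>F t in F. norm (d t * f t) \<le> C * (d t * (1 + \<bar>W t\<bar>) ^ k)"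
    using C(2) d_pos
  proof eventually_elim
    case (elim t)
    hence "d t * \<bar>f t\<bar> \<le> d t * (C * (1 + \<bar>W t\<bar>) ^ k)" by simp
    thus ?case using elim by (simp add: abs_mult mult_ac)
  qed
  ultimately show ?thesis by (rule Lim_null_comparison[rotated])
qed

lemma tame_P: "tame P"
  by (rule tame_bounded[of _ 1]) (use P_bounds e_pos in \<open>auto elim!: eventually_mono\<close>)

lemma tame_divide_P: 
  assumes "tame f" shows "tame (\<lambda>t. f t / P t)"
proof -
  have "\<forall>\<^sub>F t in F. \<bar>inverse (P t)\<bar> \<le> inverse e"
    using P_bounds by eventually_elim (use e_pos in \<open>auto intro!: le_imp_inverse_le\<close>)
  from tame_mult[OF assms tame_bounded[OF this]] show ?thesis by (simp add: divide_inverse)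
qed

lemma tame_divide_1_P:
  assumes "tame f" shows "tame (\<lambda>t. f t / (1 - P t))"
proof -
  have "\<forall>\<^sub>F t in F. \<bar>inverse (1 - P t)\<bar> \<le> inverse e"
    using P_bounds by eventually_elim (use e_pos in \<open>auto intro!: le_imp_inverse_le\<close>)
  from tame_mult[OF assms tame_bounded[OF this]] show ?thesis by (simp add: divide_inverse)
qed

lemma sqrt_PQ_bounds: "\<forall>\<^sub>F t in F. e \<le> sqrt (P t * (1 - P t)) \<and> sqrt (P t * (1 - P t)) \<le> 1"
  using P_bounds
proof eventually_elim
  case (elim t)
  hence "e * e \<le> P t * (1 - P t)" "P t * (1 - P t) \<le> 1 * 1"
    using e_pos by (intro mult_mono; simp)+
  thus ?case using e_pos by (auto simp: real_le_rsqrt power2_eq_square)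
qed

lemma tame_sqrt_PQ: "tame (\<lambda>t. sqrt (P t * (1 - P t)))"
  using sqrt_PQ_bounds
  by (intro tame_bounded[of _ 1], elim eventually_mono) (use e_pos in linarith)

lemma tame_divide_sqrt_PQ:
  assumes "tame f" shows "tame (\<lambda>t. f t / sqrt (P t * (1 - P t)))"
proof -
  have "\<forall>\<^sub>F t in F. \<bar>inverse (sqrt (P t * (1 - P t)))\<bar> \<le> inverse e"
    using sqrt_PQ_bounds by eventually_elim (use e_pos in \<open>auto intro!: le_imp_inverse_le simp del: real_sqrt_mult\<close>)
  from tame_mult[OF assms tame_bounded[OF this]] show ?thesis by (simp add: divide_inverse)
qed

text \<open>The premise is itself a closure rule for division by g, so that compound denominators
  such as 3 * s^4 are reached by composing instances, as done in \<open>tame_intros\<close>.\<close>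

lemma tame_divide_power:
  assumes "\<And>f. tame f \<Longrightarrow> tame (\<lambda>t. f t / g t)" "tame f"
  shows "tame (\<lambda>t. f t / g t ^ k)"
  using assms(2)
proof (induction k)
  case (Suc k)
  from assms(1)[OF Suc.IH[OF Suc.prems]] show ?case by (simp add: mult_ac)
qed simp

lemma tame_divide_mult:
  assumes "\<And>f. tame f \<Longrightarrow> tame (\<lambda>t. f t / g t)" "\<And>f. tame f \<Longrightarrow> tame (\<lambda>t. f t / h t)" "tame f"
  shows "tame (\<lambda>t. f t / (g t * h t))"
  using assms(2)[OF assms(1)[OF assms(3)]] by simp

lemma tame_divide_const: "tame f \<Longrightarrow> tame (\<lambda>t. f t / c)"
  using tame_mult[OF _ tame_const, of f "inverse c"] by (simp add: divide_inverse)

text \<open>The argument \<open>d t * f t\<close> tends to 0 and is thus eventually within 1/2,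
  where \<open>ln_rem\<close> is bounded by 2. This is why all logarithms in
  \<open>log_density_err\<close> have the form ln (1 + d * f).\<close>

lemma tame_ln_rem:
  assumes "tame f"
  shows "tame (\<lambda>t. ln_rem m (d t * f t))"
proof (rule tame_bounded[of _ 2])
  have "\<forall>\<^sub>F t in F. dist (d t * f t) 0 < 1 / 2"
    using d_mult_tame_tendsto_0[OF assms] by (rule tendstoD) auto
  thus "\<forall>\<^sub>F t in F. \<bar>ln_rem m (d t * f t)\<bar> \<le> 2"
    by eventually_elim (auto intro!: abs_ln_rem_le)
qed

lemmas tame_basic = tame_const tame_W tame_d tame_P tame_sqrt_PQ tame_add tame_diff tame_uminus tame_mult
  tame_power tame_ln_rem tame_divide_const tame_divide_P tame_divide_1_P tame_divide_sqrt_PQ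

lemmas tame_intros = tame_basic tame_divide_power[OF tame_divide_P] tame_divide_power[OF tame_divide_1_P] 
  tame_divide_power[OF tame_divide_sqrt_PQ] 
  tame_divide_mult[OF tame_divide_P tame_divide_1_P]
  tame_divide_mult[OF tame_divide_const tame_divide_1_P]
  tame_divide_mult[OF tame_divide_const tame_divide_power[OF tame_divide_1_P]]
  tame_divide_mult[OF tame_divide_const tame_divide_power[OF tame_divide_sqrt_PQ]]

lemma tame_cf_dev: "tame (\<lambda>t. cf_dev (d t) (P t) (W t))"
  unfolding cf_dev_def cf1_def cf2_def cfA_def cfB_def cfb_def cfa_def
  by (intro tame_intros)

lemma tame_log_density_rem: "tame (\<lambda>t. log_density_rem (d t) (P t) (W t))"
  unfolding log_density_rem_def Let_def cf1_def cf2_def cfA_def cfB_def cfb_def cfa_def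
  by (intro tame_intros tame_cf_dev)

lemma tame_cf_dev'_1: "tame (\<lambda>t. (2 * cfB (P t) * W t) / sqrt (P t * (1 - P t)) + d t * ((cfa (P t) + 3 * cfb (P t) * (W t)\<^sup>2) / (P t * (1 - P t))))"
  unfolding cf1_def cf2_def cfA_def cfB_def cfb_def cfa_def
  by (intro tame_intros)

text \<open>The second eventual bound, by 1, is what allows exp r - 1 to be estimated linearly in
  the error r afterwards.\<close>

lemma log_density_err_bound:
  obtains C k where "C > 0"
    "\<forall>\<^sub>F t in F. \<bar>log_density_err (d t) (P t) (W t)\<bar> \<le> C * d t ^ 3 * (1 + \<bar>W t\<bar>) ^ k"
    "\<forall>\<^sub>F t in F. C * d t ^ 3 * (1 + \<bar>W t\<bar>) ^ k \<le> 1"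
proof -
  obtain C k where C: "C > 0" "\<forall>\<^sub>F t in F. \<bar>log_density_rem (d t) (P t) (W t)\<bar> \<le> C * (1 + \<bar>W t\<bar>) ^ k"
    using tame_nonneg_const[OF tame_log_density_rem] .
  have 1: "\<forall>\<^sub>F t in F. \<bar>log_density_err (d t) (P t) (W t)\<bar> \<le> C * d t ^ 3 * (1 + \<bar>W t\<bar>) ^ k"
    using C(2) d_pos P_bounds
  proof eventually_elim
    case (elim t)
    have "\<bar>log_density_err (d t) (P t) (W t)\<bar> = d t ^ 3 * \<bar>log_density_rem (d t) (P t) (W t)\<bar>"
      using elim e_pos by (subst log_density_err_eq) (auto simp: abs_mult)
    also have "\<dots> \<le> d t ^ 3 * (C * (1 + \<bar>W t\<bar>) ^ k)"
      using elim by (intro mult_left_mono) auto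
    finally show ?case by (simp add: mult_ac)
  qed
  \<comment> \<open>One factor d of d^3 is set aside: the product of d with a tame function tends to
    0.\<close>
  have "tame (\<lambda>t. C * (d t)\<^sup>2 * (1 + \<bar>W t\<bar>) ^ k)"
  proof (intro tame_mult tame_const tame_power tame_d)
    show "tame (\<lambda>t. 1 + \<bar>W t\<bar>)" 
      unfolding tame_def by (rule exI[of _ 1], rule exI[of _ 1]) simp
  qed
  from order_tendstoD(2)[OF d_mult_tame_tendsto_0[OF this], of 1]
  have "\<forall>\<^sub>F t in F. C * d t ^ 3 * (1 + \<bar>W t\<bar>) ^ k \<le> 1"
    by (auto elim!: eventually_mono simp: power2_eq_square power3_eq_cube mult_ac)
  with 1 C(1) show ?thesis using that by blast
qed

end

text \<open>
  Encodes uniformity in \<open>x\<close> and \<open>w\<close>: \<open>n\<close> tends to infinity while \<open>x / n\<close> stays in \<open>[e, 1 - e]\<close>. The window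
  \<open>\<bar>w\<bar> \<le> ln n\<close> is small against every power of \<open>n\<close>, yet leaves Gaussian tails of order \<open>o(1 / n\<^sup>k)\<close> for all \<open>k\<close>.
\<close>

definition central :: "real \<Rightarrow> (nat \<times> nat \<times> real) filter" where
  "central e = inf (filtercomap fst at_top)
     (principal {(n, x, w). e * real n \<le> real x \<and> real x \<le> (1 - e) * real n \<and> \<bar>w\<bar> \<le> ln (real n)})"

lemma eventually_central:
  "eventually R (central e) \<longleftrightarrow> (\<exists>N. \<forall>n\<ge>N. \<forall>x w. e * real n \<le> real x \<longrightarrow> real x \<le> (1 - e) * real n \<longrightarrow>
      \<bar>w\<bar> \<le> ln (real n) \<longrightarrow> R (n, x, w))"
  unfolding central_def eventually_inf_principal eventually_filtercomap_at_top_linorder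
  by fastforce

lemma eventually_central_nat:
  assumes "eventually R sequentially"
  shows "\<forall>\<^sub>F t in central e. R (fst t)"
  using assms unfolding eventually_central eventually_sequentially by auto

section \<open>The approximate quantile and the density of \<open>w\<close>\<close>

text \<open>The polynomial T of the overview. As a polynomial it may leave [0, 1]; that it stays
  inside for w in the window is part of \<open>cf_quantile_density\<close>.\<close>

definition cf_quantile :: "nat \<Rightarrow> nat \<Rightarrow> real \<Rightarrow> real" where
  "cf_quantile n x w = real x / real n + (1 / sqrt (real n)) * cf_dev (1 / sqrt (real n)) (real x / real n) w"

text \<open>
  The normalising constant of the density of \<open>w\<close>. It is never estimated directly (by Stirling's
  formula, say): total mass one forces it to be \<open>1 + O(d\<^sup>3)\<close>.
\<close>

definition cf_scale :: "nat \<Rightarrow> nat \<Rightarrow> real" where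
  "cf_scale n x = (let P = real x / real n; d = 1 / sqrt (real n) in
     real (n - x) * real (n choose x) * P ^ x * (1 - P) ^ (n - x - 1)
       * (d * sqrt (P * (1 - P))) * exp (d\<^sup>2 * cf_const P) * sqrt (2 * pi))"

lemma has_real_derivative_cf_dev:
  "(cf_dev d P has_real_derivative cf_dev' d P w) (at w)"
proof -
  have "(cf_dev d P has_real_derivative (sqrt (P * (1 - P)) * 1 + d * (0 + cfB P * (2 * w))
      + d\<^sup>2 * ((cfa P * 1 + cfb P * (3 * w\<^sup>2)) / sqrt (P * (1 - P))))) (at w)"
    unfolding cf_dev_def cf1_def cf2_def
    by (intro DERIV_add DERIV_cmult DERIV_cdivide DERIV_const DERIV_ident DERIV_cong[OF DERIV_pow]) auto
  thus ?thesis by (simp add: cf_dev'_def mult_ac)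
qed

lemma has_real_derivative_cf_quantile:
  "(cf_quantile n x has_real_derivative (1 / sqrt (real n)) * cf_dev' (1 / sqrt (real n)) (real x / real n) w) (at w)"
  unfolding cf_quantile_def
  by (rule DERIV_cong[OF DERIV_add[OF DERIV_const DERIV_cmult[OF has_real_derivative_cf_dev]]]) simp

text \<open>Pulling out the leading factor leaves 1 + d * (...), the argument of the third logarithm
  in \<open>log_density_err\<close>.\<close>

lemma cf_dev'_eq:
  assumes "0 < P" "P < 1"
  shows "cf_dev' d P w = sqrt (P * (1 - P)) *
     (1 + d * ((2 * cfB P * w) / sqrt (P * (1 - P)) + d * ((cfa P + 3 * cfb P * w\<^sup>2) / (P * (1 - P)))))"
proof -
  define s where "s = sqrt (P * (1 - P))"
  have s: "s > 0" "s * s = P * (1 - P)" using assms by (auto simp: s_def)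
  have "s * (1 + d * ((2 * cfB P * w) / s + d * ((cfa P + 3 * cfb P * w\<^sup>2) / (s * s))))
      = s + d * (2 * cfB P * w) + d\<^sup>2 * ((cfa P + 3 * cfb P * w\<^sup>2) / s)"
    using s(1) by (simp add: field_simps power2_eq_square)
  thus ?thesis by (simp add: cf_dev'_def s(2) flip: s_def)
qed

text \<open>No asymptotics enter: by the chain rule the left side is the density of w, and
  \<open>log_density_err\<close> and \<open>cf_scale\<close> are made so that its logarithm splits
  exactly. Positivity of the three factors justifies passing through ln.\<close>

lemma slope_cf_quantile:
  fixes n x :: nat and w :: real
  defines "P \<equiv> real x / real n" and "d \<equiv> 1 / sqrt (real n)"
  assumes x: "0 < x" "x < n"
    and pos: "0 < 1 + d * (cf_dev d P w / P)" "0 < 1 + d * (- cf_dev d P w / (1 - P))"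
      "0 < 1 + d * ((2 * cfB P * w) / sqrt (P * (1 - P)) + d * ((cfa P + 3 * cfb P * w\<^sup>2) / (P * (1 - P))))"
  shows "binom_cdf_slope n x (cf_quantile n x w) * (d * cf_dev' d P w)
     = cf_scale n x * std_normal_density w * exp (log_density_err d P w)"
proof -
  define y1 where "y1 = 1 + d * (cf_dev d P w / P)"
  define y2 where "y2 = 1 + d * (- cf_dev d P w / (1 - P))"
  define y3 where "y3 = 1 + d * ((2 * cfB P * w) / sqrt (P * (1 - P)) + d * ((cfa P + 3 * cfb P * w\<^sup>2) / (P * (1 - P))))"
  have P: "0 < P" "P < 1" using x by (auto simp: P_def)
  have y: "y1 > 0" "y2 > 0" "y3 > 0" using pos by (auto simp: y1_def y2_def y3_def)
  have T: "cf_quantile n x w = P * y1" "1 - cf_quantile n x w = (1 - P) * y2"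
  proof -
    have "cf_quantile n x w = P + d * cf_dev d P w"
      unfolding cf_quantile_def P_def d_def ..
    thus "cf_quantile n x w = P * y1" "1 - cf_quantile n x w = (1 - P) * y2"
      using P by (simp_all add: y1_def y2_def distrib_left right_diff_distrib)
  qed
  have d2: "1 / d\<^sup>2 = real n" using x by (simp add: d_def power_divide)
  define m where "m = n - x - 1"
  have nx: "real n = real x + real m + 1" using x by (simp add: m_def)
  have Pn: "P * real n = real x" "(1 - P) * real n = real m + 1"
  proof -
    show *: "P * real n = real x" using x by (simp add: P_def)
    show "(1 - P) * real n = real m + 1" unfolding left_diff_distrib * using nx by simp
  qed
  have "(P * ln y1 + (1 - P) * ln y2) / d\<^sup>2 = (P * ln y1 + (1 - P) * ln y2) * real n"
    by (simp add: d2[symmetric])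
  also have "\<dots> = (P * real n) * ln y1 + ((1 - P) * real n) * ln y2" by (simp add: algebra_simps)
  also have "\<dots> = real x * ln y1 + (real m + 1) * ln y2" by (simp only: Pn)
  finally have *: "(P * ln y1 + (1 - P) * ln y2) / d\<^sup>2 = real x * ln y1 + (real m + 1) * ln y2" .
  \<comment> \<open>The exponent of 1 - u in the slope is \<open>m = n - x - 1\<close>, one less
    than (1 - P) * n; the separate term - ln y2 accounts for the difference.\<close>
  have "log_density_err d P w = real x * ln y1 + (real m + 1) * ln y2 - ln y2 + ln y3 + w\<^sup>2 / 2 - d\<^sup>2 * cf_const P"
    unfolding log_density_err_def y1_def[symmetric] y2_def[symmetric] y3_def[symmetric] * ..
  hence **: "log_density_err d P w = real x * ln y1 + real m * ln y2 + ln y3 + w\<^sup>2 / 2 - d\<^sup>2 * cf_const P"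
    by (simp add: distrib_right)
  have err: "exp (log_density_err d P w) = y1 ^ x * y2 ^ m * y3 * exp (w\<^sup>2 / 2) / exp (d\<^sup>2 * cf_const P)"
    unfolding ** exp_add exp_diff exp_of_nat_mult exp_ln[OF y(1)] exp_ln[OF y(2)] exp_ln[OF y(3)] ..
  have density: "std_normal_density w = 1 / (sqrt (2 * pi) * exp (w\<^sup>2 / 2))"
  proof -
    have "exp (- w\<^sup>2 / 2) = 1 / exp (w\<^sup>2 / 2)"
      using exp_minus[of "w\<^sup>2 / 2"] by (simp add: inverse_eq_divide)
    thus ?thesis unfolding std_normal_density_def by simp
  qed
  define K where "K = real (n - x) * real (n choose x) * P ^ x * (1 - P) ^ m * (d * sqrt (P * (1 - P)))"
  have scale: "cf_scale n x = K * exp (d\<^sup>2 * cf_const P) * sqrt (2 * pi)"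
    unfolding cf_scale_def Let_def K_def P_def d_def m_def ..
  have "K * c * r * (1 / (r * g)) * (Z * g / c) = K * Z" if "c > 0" "r > 0" "g > 0" for c r g Z
    using that by simp
  hence "cf_scale n x * std_normal_density w * exp (log_density_err d P w) = K * (y1 ^ x * y2 ^ m * y3)"
    unfolding err density scale by simp
  also have "\<dots> = binom_cdf_slope n x (cf_quantile n x w) * (d * cf_dev' d P w)"
    unfolding binom_cdf_slope_def T(2) unfolding T(1) cf_dev'_eq[OF P] K_def m_def y3_def[symmetric] power_mult_distrib
    by (simp add: mult_ac)
  finally show ?thesis by simp
qed

lemma power_le_fact_exp: "0 \<le> y \<Longrightarrow> y ^ m \<le> fact m * exp (y::real)"
proof (induction m arbitrary: y)
  case (Suc m)
  have "0 \<le> fact (Suc m) * exp 0 - (0::real) ^ Suc m" by simp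
  also have "\<dots> \<le> fact (Suc m) * exp y - y ^ Suc m"
  proof (rule DERIV_nonneg_imp_nondecreasing[OF Suc.prems])
    fix t :: real assume "0 \<le> t"
    hence "0 \<le> (1 + real m) * (fact m * exp t - t ^ m)" using Suc.IH[of t] by simp
    moreover have "((\<lambda>y. fact (Suc m) * exp y - y ^ Suc m) has_real_derivative
        fact (Suc m) * exp t - real (Suc m) * t ^ m) (at t)"
      by (intro DERIV_diff DERIV_cmult DERIV_exp) (use DERIV_pow[of "Suc m" t] in simp)
    ultimately show "\<exists>D. ((\<lambda>y. fact (Suc m) * exp y - y ^ Suc m) has_real_derivative D) (at t) \<and> 0 \<le> D"
      by (intro exI[of _ "fact (Suc m) * exp t - real (Suc m) * t ^ m"]) (auto simp: algebra_simps)
  qed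
  finally show ?case by simp
qed simp

text \<open>Trades the polynomial factor in the error for 1 / (1 + w^2), whose integral over the
  line is pi, so that the error stays bounded on windows of any length.\<close>

lemma std_normal_density_power_le:
  obtains C where "C > 0" "\<And>w. std_normal_density w * (1 + \<bar>w\<bar>) ^ k \<le> C * inverse (1 + w\<^sup>2)"
proof -
  \<comment> \<open>The exponent k + 2 arises from 1 + w^2 \<le> (1 + \<bar>w\<bar>)^2, and 3/2 is
    the maximum of - w^2 / 2 + 1 + \<bar>w\<bar>.\<close>
  define C :: real where "C = fact (k + 2) * exp (3 / 2)"
  have "std_normal_density w * (1 + \<bar>w\<bar>) ^ k \<le> C * inverse (1 + w\<^sup>2)" for w
  proof -
    have "sqrt (2 * pi) \<ge> 1" using pi_gt3 by simp
    hence "1 / sqrt (2 * pi) \<le> 1" by simp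
    hence 1: "std_normal_density w \<le> 1 * exp (- w\<^sup>2 / 2)"
      unfolding std_normal_density_def by (intro mult_right_mono) auto
    have "(1 + \<bar>w\<bar>) ^ k * (1 + w\<^sup>2) \<le> (1 + \<bar>w\<bar>) ^ k * (1 + \<bar>w\<bar>)\<^sup>2"
      by (intro mult_left_mono) (auto simp: power2_eq_square algebra_simps)
    also have "\<dots> = (1 + \<bar>w\<bar>) ^ (k + 2)" by (simp add: power_add power2_eq_square)
    also have "\<dots> \<le> fact (k + 2) * exp (1 + \<bar>w\<bar>)" by (rule power_le_fact_exp) auto
    finally have 2: "(1 + \<bar>w\<bar>) ^ k * (1 + w\<^sup>2) \<le> fact (k + 2) * exp (1 + \<bar>w\<bar>)" .
    have "(\<bar>w\<bar> - 1)\<^sup>2 \<ge> 0" by simp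
    hence 3: "- w\<^sup>2 / 2 + (1 + \<bar>w\<bar>) \<le> 3 / 2"
      by (simp add: power2_eq_square algebra_simps)
    have "std_normal_density w * ((1 + \<bar>w\<bar>) ^ k * (1 + w\<^sup>2)) \<le>
        exp (- w\<^sup>2 / 2) * (fact (k + 2) * exp (1 + \<bar>w\<bar>))"
      by (intro mult_mono 2 order_trans[OF 1]) auto
    also have "\<dots> = fact (k + 2) * exp (- w\<^sup>2 / 2 + (1 + \<bar>w\<bar>))" by (simp only: exp_add[of "- w\<^sup>2 / 2"] mult_ac)
    also have "\<dots> \<le> C" unfolding C_def using 3 by (intro mult_left_mono) auto
    finally show ?thesis
      by (simp add: field_simps add_pos_nonneg)
  qed
  thus ?thesis by (intro that[of C]) (auto simp: C_def)
qed

lemma abs_exp_minus_1_le: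
  fixes r :: real
  assumes "\<bar>r\<bar> \<le> 1"
  shows "\<bar>exp r - 1\<bar> \<le> 2 * \<bar>r\<bar>"
proof (cases "0 \<le> r")
  case True
  hence "r\<^sup>2 \<le> r * 1" unfolding power2_eq_square using assms by (intro mult_left_mono) auto
  thus ?thesis using exp_bound[of r] True assms exp_ge_add_one_self[of r] by auto
next
  case False
  moreover have "exp r \<le> 1" using False by simp
  ultimately show ?thesis using exp_ge_add_one_self[of r] by linarith
qed

lemma uniform_expansion_central:
  assumes "0 < e"
  shows "uniform_expansion (central e) (\<lambda>(n, x, w). 1 / sqrt (real n)) (\<lambda>(n, x, w). w)
     (\<lambda>(n, x, w). real x / real n) e"
proof
  show "\<forall>\<^sub>F t in central e. e \<le> (case t of (n, x, w) \<Rightarrow> real x / real n) \<and>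
      (case t of (n, x, w) \<Rightarrow> real x / real n) \<le> 1 - e"
    unfolding eventually_central by (auto intro!: exI[of _ 1] simp: field_simps)
  show "\<forall>\<^sub>F t in central e. 0 < (case t of (n, x, w) \<Rightarrow> 1 / sqrt (real n))"
    unfolding eventually_central by (auto intro!: exI[of _ 1])
  fix k :: nat
  have lim: "((\<lambda>t::nat \<times> nat \<times> real. 1 / sqrt (real (fst t)) * (1 + ln (real (fst t))) ^ k) \<longlongrightarrow> 0) (central e)"
  proof -
    have "(\<lambda>n. 1 / sqrt (real n) * (1 + ln (real n)) ^ k) \<longlonglongrightarrow> 0" by real_asymp
    thus ?thesis
      unfolding tendsto_iff by (auto dest: eventually_central_nat)
  qed
  show "((\<lambda>t. (case t of (n, x, w) \<Rightarrow> 1 / sqrt (real n)) * (1 + \<bar>case t of (n, x, w) \<Rightarrow> w\<bar>) ^ k) \<longlongrightarrow> 0)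
      (central e)"
  proof (rule Lim_null_comparison[OF _ lim])
    show "\<forall>\<^sub>F t in central e. norm ((case t of (n, x, w) \<Rightarrow> 1 / sqrt (real n)) *
        (1 + \<bar>case t of (n, x, w) \<Rightarrow> w\<bar>) ^ k) \<le> 1 / sqrt (real (fst t)) * (1 + ln (real (fst t))) ^ k"
      unfolding eventually_central
      by (auto intro!: exI[of _ 1] divide_right_mono power_mono simp: abs_mult power_abs)
  qed
qed (use assms in auto)

section \<open>Comparison with the normal distribution\<close>

text \<open>The arctangent serves as an explicit, bounded antiderivative of the error density.\<close>

lemma increment_Phi_bound:
  assumes "a \<le> b" "0 \<le> c"
    and J: "\<And>w. a \<le> w \<Longrightarrow> w \<le> b \<Longrightarrow> (J has_real_derivative D w) (at w)"
    and D: "\<And>w. a \<le> w \<Longrightarrow> w \<le> b \<Longrightarrow> \<bar>D w - K * std_normal_density w\<bar> \<le> c * inverse (1 + w\<^sup>2)"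
  shows "\<bar>J b - J a - K * (Phi b - Phi a)\<bar> \<le> c * pi"
proof -
  have 1: "J a - K * Phi a + c * arctan a \<le> J b - K * Phi b + c * arctan b"
  proof (rule DERIV_nonneg_imp_nondecreasing[OF \<open>a \<le> b\<close>])
    fix w assume w: "a \<le> w" "w \<le> b"
    have "((\<lambda>w. J w - K * Phi w + c * arctan w) has_real_derivative
        (D w - K * std_normal_density w + c * inverse (1 + w\<^sup>2))) (at w)"
      by (intro DERIV_add DERIV_diff DERIV_cmult J[OF w] has_real_derivative_Phi DERIV_arctan)
    moreover have "\<bar>D w - K * std_normal_density w\<bar> \<le> c * inverse (1 + w\<^sup>2)" by (rule D[OF w])
    ultimately show "\<exists>y. ((\<lambda>w. J w - K * Phi w + c * arctan w) has_real_derivative y) (at w) \<and> 0 \<le> y"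
      by (intro exI[of _ "D w - K * std_normal_density w + c * inverse (1 + w\<^sup>2)"] conjI) (assumption, linarith)
  qed
  have 2: "J b - K * Phi b - c * arctan b \<le> J a - K * Phi a - c * arctan a"
  proof (rule DERIV_nonpos_imp_nonincreasing[OF \<open>a \<le> b\<close>])
    fix w assume w: "a \<le> w" "w \<le> b"
    have "((\<lambda>w. J w - K * Phi w - c * arctan w) has_real_derivative
        (D w - K * std_normal_density w - c * inverse (1 + w\<^sup>2))) (at w)"
      by (intro DERIV_diff DERIV_cmult J[OF w] has_real_derivative_Phi DERIV_arctan)
    moreover have "\<bar>D w - K * std_normal_density w\<bar> \<le> c * inverse (1 + w\<^sup>2)" by (rule D[OF w])
    ultimately show "\<exists>y. ((\<lambda>w. J w - K * Phi w - c * arctan w) has_real_derivative y) (at w) \<and> y \<le> 0"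
      by (intro exI[of _ "D w - K * std_normal_density w - c * inverse (1 + w\<^sup>2)"] conjI) (assumption, linarith)
  qed
  have "c * (arctan b - arctan a) \<le> c * pi"
    using arctan_ubound[of b] arctan_lbound[of a] \<open>0 \<le> c\<close> by (intro mult_left_mono) auto
  thus ?thesis using 1 2 unfolding abs_le_iff right_diff_distrib by linarith
qed

text \<open>The error is stated relative to \<open>cf_scale n x\<close>, because that constant has
  not been controlled yet. The second group of facts prepares the Hoeffding bounds at the ends of
  the window.\<close>

lemma cf_quantile_density:
  assumes e: "0 < e"
  obtains C N where "C > 0"
    "\<And>n x w. n \<ge> N \<Longrightarrow> e * real n \<le> real x \<Longrightarrow> real x \<le> (1 - e) * real n \<Longrightarrow> \<bar>w\<bar> \<le> ln (real n) \<Longrightarrow>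
      0 < cf_scale n x \<and>
      \<bar>binom_cdf_slope n x (cf_quantile n x w) * (1 / sqrt (real n) * cf_dev' (1 / sqrt (real n)) (real x / real n) w)
        - cf_scale n x * std_normal_density w\<bar> \<le> cf_scale n x * (C * (1 / sqrt (real n)) ^ 3) * inverse (1 + w\<^sup>2)"
    "\<And>n x w. n \<ge> N \<Longrightarrow> e * real n \<le> real x \<Longrightarrow> real x \<le> (1 - e) * real n \<Longrightarrow> \<bar>w\<bar> \<le> ln (real n) \<Longrightarrow>
      0 \<le> cf_quantile n x w \<and> cf_quantile n x w \<le> 1 \<and>
      \<bar>cf_dev (1 / sqrt (real n)) (real x / real n) w - sqrt (real x / real n * (1 - real x / real n)) * w\<bar> \<le> 1 \<and>
      e \<le> sqrt (real x / real n * (1 - real x / real n))"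
proof -
  define d :: "nat \<times> nat \<times> real \<Rightarrow> real" where "d = (\<lambda>(n, x, w). 1 / sqrt (real n))"
  define P :: "nat \<times> nat \<times> real \<Rightarrow> real" where "P = (\<lambda>(n, x, w). real x / real n)"
  define W :: "nat \<times> nat \<times> real \<Rightarrow> real" where "W = (\<lambda>(n, x, w). w)"
  have app: "d (n, x, w) = 1 / sqrt (real n)" "P (n, x, w) = real x / real n" "W (n, x, w) = w" for n x w
    by (auto simp: d_def P_def W_def)
  interpret uniform_expansion "central e" d W P e
    using uniform_expansion_central[OF e] by (simp add: d_def P_def W_def)
  obtain C1 k where C1: "C1 > 0"
    "\<forall>\<^sub>F t in central e. \<bar>log_density_err (d t) (P t) (W t)\<bar> \<le> C1 * d t ^ 3 * (1 + \<bar>W t\<bar>) ^ k"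
    "\<forall>\<^sub>F t in central e. C1 * d t ^ 3 * (1 + \<bar>W t\<bar>) ^ k \<le> 1"
    using log_density_err_bound .
  obtain C2 where C2: "C2 > 0" "\<And>w. std_normal_density w * (1 + \<bar>w\<bar>) ^ k \<le> C2 * inverse (1 + w\<^sup>2)"
    by (rule std_normal_density_power_le[of k]) blast
  have y: "\<forall>\<^sub>F t in central e. 0 < 1 + d t * (f t)" if "tame f" for f
  proof -
    have "\<forall>\<^sub>F t in central e. -1 < d t * (f t)"
      using order_tendstoD(1)[OF d_mult_tame_tendsto_0[OF that], of "-1"] by simp
    thus ?thesis by eventually_elim linarith
  qed
  \<comment> \<open>This quantity is the difference between \<open>cf_dev\<close> and its leading
    term, so the ends of the window are displaced from x / n by essentially sqrt (P * (1 - P)) * ln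
    n standard units.\<close>
  have dev: "\<forall>\<^sub>F t in central e. \<bar>d t * (cf1 (P t) (W t) + d t * cf2 (P t) (W t))\<bar> < 1"
  proof -
    have "tame (\<lambda>t. cf1 (P t) (W t) + d t * cf2 (P t) (W t))"
      unfolding cf1_def cf2_def cfA_def cfB_def cfb_def cfa_def by (intro tame_intros)
    from tendstoD[OF d_mult_tame_tendsto_0[OF this], of 1] show ?thesis by simp
  qed
  note ev = eventually_conj[OF C1(2) eventually_conj[OF C1(3) eventually_conj[OF y[OF tame_divide_P[OF tame_cf_dev]]
    eventually_conj[OF y[OF tame_divide_1_P[OF tame_uminus[OF tame_cf_dev]]] eventually_conj[OF y[OF tame_cf_dev'_1]
     eventually_conj[OF dev sqrt_PQ_bounds]]]]]]
  have "\<exists>N. \<forall>n\<ge>N. \<forall>x w. e * real n \<le> real x \<longrightarrow> real x \<le> (1 - e) * real n \<longrightarrow> \<bar>w\<bar> \<le> ln (real n) \<longrightarrow>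
     (let d = 1 / sqrt (real n); P = real x / real n in
      \<bar>log_density_err d P w\<bar> \<le> C1 * d ^ 3 * (1 + \<bar>w\<bar>) ^ k \<and> C1 * d ^ 3 * (1 + \<bar>w\<bar>) ^ k \<le> 1 \<and>
      0 < 1 + d * (cf_dev d P w / P) \<and> 0 < 1 + d * (- cf_dev d P w / (1 - P)) \<and>
      0 < 1 + d * ((2 * cfB P * w) / sqrt (P * (1 - P)) + d * ((cfa P + 3 * cfb P * w\<^sup>2) / (P * (1 - P)))) \<and>
      \<bar>d * (cf1 P w + d * cf2 P w)\<bar> < 1 \<and> e \<le> sqrt (P * (1 - P)) \<and> sqrt (P * (1 - P)) \<le> 1)"
    using ev unfolding eventually_central app Let_def .
  then obtain N where N: "\<forall>n\<ge>N. \<forall>x w. e * real n \<le> real x \<longrightarrow> real x \<le> (1 - e) * real n \<longrightarrow> \<bar>w\<bar> \<le> ln (real n) \<longrightarrow>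
     (let d = 1 / sqrt (real n); P = real x / real n in
      \<bar>log_density_err d P w\<bar> \<le> C1 * d ^ 3 * (1 + \<bar>w\<bar>) ^ k \<and> C1 * d ^ 3 * (1 + \<bar>w\<bar>) ^ k \<le> 1 \<and>
      0 < 1 + d * (cf_dev d P w / P) \<and> 0 < 1 + d * (- cf_dev d P w / (1 - P)) \<and>
      0 < 1 + d * ((2 * cfB P * w) / sqrt (P * (1 - P)) + d * ((cfa P + 3 * cfb P * w\<^sup>2) / (P * (1 - P)))) \<and>
      \<bar>d * (cf1 P w + d * cf2 P w)\<bar> < 1 \<and> e \<le> sqrt (P * (1 - P)) \<and> sqrt (P * (1 - P)) \<le> 1)" ..
  show ?thesis
  proof (rule that[of "2 * C1 * C2" "max N 1"])
    show "2 * C1 * C2 > 0" using C1 C2 by simp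
    fix n x :: nat and w :: real
    assume asm: "n \<ge> max N 1" "e * real n \<le> real x" "real x \<le> (1 - e) * real n" "\<bar>w\<bar> \<le> ln (real n)"
    define d where "d = 1 / sqrt (real n)"
    define P where "P = real x / real n"
    define V where "V = cf_dev d P w"
    have n: "n > 0" using asm by simp
    have d: "d > 0" using n by (simp add: d_def)
    have "0 < e * real n" using n e by simp
    hence x: "0 < x" using asm(2) by linarith
    have "(1 - e) * real n < 1 * real n" using n e by (intro mult_strict_right_mono) auto
    hence x': "x < n" using asm(3) by linarith
    have P: "0 < P" "P < 1" using x x' by (auto simp: P_def)
    have N': "n \<ge> N" using asm by simp
    have "\<bar>log_density_err d P w\<bar> \<le> C1 * d ^ 3 * (1 + \<bar>w\<bar>) ^ k \<and> C1 * d ^ 3 * (1 + \<bar>w\<bar>) ^ k \<le> 1 \<and>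
      0 < 1 + d * (cf_dev d P w / P) \<and> 0 < 1 + d * (- cf_dev d P w / (1 - P)) \<and>
      0 < 1 + d * ((2 * cfB P * w) / sqrt (P * (1 - P)) + d * ((cfa P + 3 * cfb P * w\<^sup>2) / (P * (1 - P)))) \<and>
      \<bar>d * (cf1 P w + d * cf2 P w)\<bar> < 1 \<and> e \<le> sqrt (P * (1 - P)) \<and> sqrt (P * (1 - P)) \<le> 1"
      using N[rule_format, OF N' asm(2-4)] unfolding Let_def d_def P_def .
    then have err: "\<bar>log_density_err d P w\<bar> \<le> C1 * d ^ 3 * (1 + \<bar>w\<bar>) ^ k" "C1 * d ^ 3 * (1 + \<bar>w\<bar>) ^ k \<le> 1"
      and pos1: "0 < 1 + d * (cf_dev d P w / P)" and pos2: "0 < 1 + d * (- cf_dev d P w / (1 - P))"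
      and pos3: "0 < 1 + d * ((2 * cfB P * w) / sqrt (P * (1 - P)) + d * ((cfa P + 3 * cfb P * w\<^sup>2) / (P * (1 - P))))"
      and small: "\<bar>d * (cf1 P w + d * cf2 P w)\<bar> < 1" and sqrt_ge: "e \<le> sqrt (P * (1 - P))"
      by blast+
    have eq: "binom_cdf_slope n x (cf_quantile n x w) * (d * cf_dev' d P w)
       = cf_scale n x * std_normal_density w * exp (log_density_err d P w)"
      using pos1 pos2 pos3 unfolding d_def P_def by (intro slope_cf_quantile x x')
    have scale: "0 < cf_scale n x"
      using P x x' n d unfolding cf_scale_def Let_def P_def[symmetric] d_def[symmetric]
      by (intro mult_pos_pos) (simp_all del: real_sqrt_mult)
    have "\<bar>exp (log_density_err d P w) - 1\<bar> \<le> 2 * \<bar>log_density_err d P w\<bar>"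
      using err by (intro abs_exp_minus_1_le) linarith
    also have "\<dots> \<le> 2 * (C1 * d ^ 3 * (1 + \<bar>w\<bar>) ^ k)" using err by linarith
    finally have "std_normal_density w * \<bar>exp (log_density_err d P w) - 1\<bar> \<le>
        std_normal_density w * (2 * (C1 * d ^ 3 * (1 + \<bar>w\<bar>) ^ k))"
      by (intro mult_left_mono) auto
    also have "\<dots> = 2 * C1 * d ^ 3 * (std_normal_density w * (1 + \<bar>w\<bar>) ^ k)" by simp
    also have "\<dots> \<le> 2 * C1 * d ^ 3 * (C2 * inverse (1 + w\<^sup>2))"
      using C1 d by (intro mult_left_mono C2) auto
    finally have le: "std_normal_density w * \<bar>exp (log_density_err d P w) - 1\<bar> \<le> 2 * C1 * C2 * d ^ 3 * inverse (1 + w\<^sup>2)"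
      by (simp add: mult_ac)
    have "\<bar>binom_cdf_slope n x (cf_quantile n x w) * (d * cf_dev' d P w) - cf_scale n x * std_normal_density w\<bar>
       = \<bar>cf_scale n x * (std_normal_density w * (exp (log_density_err d P w) - 1))\<bar>"
      unfolding eq by (simp add: algebra_simps)
    also have "\<dots> = cf_scale n x * (std_normal_density w * \<bar>exp (log_density_err d P w) - 1\<bar>)"
      using scale by (simp add: abs_mult)
    also have "\<dots> \<le> cf_scale n x * (2 * C1 * C2 * d ^ 3 * inverse (1 + w\<^sup>2))"
      using scale le by (intro mult_left_mono) auto
    finally show "0 < cf_scale n x \<and>
      \<bar>binom_cdf_slope n x (cf_quantile n x w) * (1 / sqrt (real n) * cf_dev' (1 / sqrt (real n)) (real x / real n) w)
        - cf_scale n x * std_normal_density w\<bar> \<le> cf_scale n x * (2 * C1 * C2 * (1 / sqrt (real n)) ^ 3) * inverse (1 + w\<^sup>2)"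
      using scale unfolding d_def P_def by (simp add: mult_ac)
    have T: "cf_quantile n x w = P * (1 + d * (V / P))" "1 - cf_quantile n x w = (1 - P) * (1 + d * (- V / (1 - P)))"
    proof -
      have "cf_quantile n x w = P + d * V"
        unfolding cf_quantile_def P_def d_def V_def ..
      thus "cf_quantile n x w = P * (1 + d * (V / P))" "1 - cf_quantile n x w = (1 - P) * (1 + d * (- V / (1 - P)))"
        using P by (simp_all add: distrib_left right_diff_distrib)
    qed
    have "0 \<le> cf_quantile n x w"
      unfolding T(1) V_def using pos1 P by (intro mult_nonneg_nonneg; linarith)
    moreover have "0 \<le> 1 - cf_quantile n x w"
      unfolding T(2) V_def using pos2 P by (intro mult_nonneg_nonneg; linarith)
    moreover have "V - sqrt (P * (1 - P)) * w = d * (cf1 P w + d * cf2 P w)"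
      by (simp add: V_def cf_dev_def power2_eq_square algebra_simps)
    hence "\<bar>V - sqrt (P * (1 - P)) * w\<bar> \<le> 1" using small by linarith
    ultimately show "0 \<le> cf_quantile n x w \<and> cf_quantile n x w \<le> 1 \<and>
      \<bar>cf_dev (1 / sqrt (real n)) (real x / real n) w - sqrt (real x / real n * (1 - real x / real n)) * w\<bar> \<le> 1 \<and>
      e \<le> sqrt (real x / real n * (1 - real x / real n))"
      using sqrt_ge unfolding V_def P_def d_def by linarith
  qed
qed

lemma has_real_derivative_binom_cdf_cf_quantile:
  assumes "x < n"
  shows "((\<lambda>w. 1 - binom_cdf n x (cf_quantile n x w)) has_real_derivative
     binom_cdf_slope n x (cf_quantile n x w) * (1 / sqrt (real n) * cf_dev' (1 / sqrt (real n)) (real x / real n) w)) (at w)"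
proof -
  have "((\<lambda>w. binom_cdf n x (cf_quantile n x w)) has_real_derivative
     - binom_cdf_slope n x (cf_quantile n x w) * (1 / sqrt (real n) * cf_dev' (1 / sqrt (real n)) (real x / real n) w)) (at w)"
    by (rule DERIV_chain2[OF has_real_derivative_binom_cdf[OF assms] has_real_derivative_cf_quantile])
  from DERIV_diff[OF DERIV_const this, of 1] show ?thesis by simp
qed

text \<open>Over the whole window both distribution functions grow by 1 up to order d^3, so the
  scale K of the density is within order d^3 of 1. The increment from the left end of the window to
  w then gives the claim.\<close>

lemma binom_cdf_near_Phi:
  assumes e: "0 < e"
  obtains C N where "C > 0"
    "\<And>n x w. n \<ge> N \<Longrightarrow> e * real n \<le> real x \<Longrightarrow> real x \<le> (1 - e) * real n \<Longrightarrow> \<bar>w\<bar> \<le> ln (real n) \<Longrightarrow>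
      \<bar>1 - binom_cdf n x (cf_quantile n x w) - Phi w\<bar> \<le> C * (1 / sqrt (real n)) ^ 3"
proof -
  obtain C1 N1 where C1: "C1 > 0" and dens:
    "\<And>n x w. n \<ge> N1 \<Longrightarrow> e * real n \<le> real x \<Longrightarrow> real x \<le> (1 - e) * real n \<Longrightarrow> \<bar>w\<bar> \<le> ln (real n) \<Longrightarrow>
      0 < cf_scale n x \<and>
      \<bar>binom_cdf_slope n x (cf_quantile n x w) * (1 / sqrt (real n) * cf_dev' (1 / sqrt (real n)) (real x / real n) w)
        - cf_scale n x * std_normal_density w\<bar> \<le> cf_scale n x * (C1 * (1 / sqrt (real n)) ^ 3) * inverse (1 + w\<^sup>2)"
    and quant:
    "\<And>n x w. n \<ge> N1 \<Longrightarrow> e * real n \<le> real x \<Longrightarrow> real x \<le> (1 - e) * real n \<Longrightarrow> \<bar>w\<bar> \<le> ln (real n) \<Longrightarrow>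
      0 \<le> cf_quantile n x w \<and> cf_quantile n x w \<le> 1 \<and>
      \<bar>cf_dev (1 / sqrt (real n)) (real x / real n) w - sqrt (real x / real n * (1 - real x / real n)) * w\<bar> \<le> 1 \<and>
      e \<le> sqrt (real x / real n * (1 - real x / real n))"
    using cf_quantile_density[OF e] by blast
  obtain C2 where C2: "C2 > 0" "\<And>w. Phi w \<le> C2 * exp (3 * w)" "\<And>w. 1 - Phi w \<le> C2 * exp (- 3 * w)"
    using Phi_tail by blast
  \<comment> \<open>2 * C2 pays for the two normal tails outside the window, C1 * pi for the density
    error integrated over it.\<close>
  define A where "A = 2 * C2 + C1 * pi"
  have A: "A > 0" using C1 C2(1) by (simp add: A_def add_pos_pos)
  \<comment> \<open>With M = ln n, this threshold makes e * M - 1 at least e * M / 2, absorbing the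
    displacement by 1. The next one turns Hoeffding's exponent - 2 * (e * M / 2)^2 into at most -
    (3/2) * M, which is ln (d^3).\<close>
  have "\<forall>\<^sub>F n in sequentially. ln (real n) \<ge> 2 / e"
    by real_asymp
  moreover have "\<forall>\<^sub>F n in sequentially. e\<^sup>2 / 2 * ln (real n) \<ge> 3 / 2"
    using e by real_asymp
  moreover have "\<forall>\<^sub>F n in sequentially. A * (1 / sqrt (real n)) ^ 3 \<le> 1 / 2"
    using A by real_asymp
  moreover have "\<forall>\<^sub>F n in sequentially. n \<ge> max N1 1" by (rule eventually_ge_at_top)
  ultimately have "\<forall>\<^sub>F n in sequentially. n \<ge> max N1 1 \<and> A * (1 / sqrt (real n)) ^ 3 \<le> 1 / 2
      \<and> e\<^sup>2 / 2 * ln (real n) \<ge> 3 / 2 \<and> ln (real n) \<ge> 2 / e"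
    by eventually_elim simp
  then obtain N where N: "\<And>n. n \<ge> N \<Longrightarrow> n \<ge> max N1 1 \<and> A * (1 / sqrt (real n)) ^ 3 \<le> 1 / 2
      \<and> e\<^sup>2 / 2 * ln (real n) \<ge> 3 / 2 \<and> ln (real n) \<ge> 2 / e"
    unfolding eventually_sequentially by blast
  define C where "C = 2 * C1 * pi + 1 + 2 * C2 + 2 * A + 2 * C1 * pi + 2"
  have "\<bar>1 - binom_cdf n x (cf_quantile n x w) - Phi w\<bar> \<le> C * (1 / sqrt (real n)) ^ 3"
    if asm: "n \<ge> N" "e * real n \<le> real x" "real x \<le> (1 - e) * real n" "\<bar>w\<bar> \<le> ln (real n)" for n x w
  proof -
    define d where "d = 1 / sqrt (real n)"
    define M where "M = ln (real n)"
    define K where "K = cf_scale n x"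
    define J where "J = (\<lambda>w. 1 - binom_cdf n x (cf_quantile n x w))"
    have n: "n \<ge> N1" "n > 0" "A * d ^ 3 \<le> 1 / 2" "e\<^sup>2 / 2 * M \<ge> 3 / 2" "M \<ge> 2 / e"
      using N[OF asm(1)] by (auto simp: d_def M_def)
    have M: "M > 0" using n(5) e by (meson divide_pos_pos less_le_trans zero_less_numeral)
    have d: "d > 0" using n by (simp add: d_def)
    have d3: "d ^ 3 = exp (- (3 / 2) * M)"
    proof -
      have "d = exp (- (1 / 2) * M)"
        using n(2) by (simp add: d_def M_def exp_minus ln_sqrt[symmetric] inverse_eq_divide)
      thus ?thesis by (simp add: exp_of_nat_mult[symmetric])
    qed
    have "(1 - e) * real n < 1 * real n" using n e by (intro mult_strict_right_mono) auto
    hence x': "x < n" using asm(3) by linarith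
    note dens = dens[OF n(1) asm(2,3), folded M_def K_def d_def]
    note quant = quant[OF n(1) asm(2,3), folded M_def d_def]
    have K: "K > 0" using dens[of 0] M by simp
    have incr: "\<bar>J b - J a - K * (Phi b - Phi a)\<bar> \<le> K * (C1 * d ^ 3) * pi" if "- M \<le> a" "a \<le> b" "b \<le> M" for a b
    proof (rule increment_Phi_bound[OF that(2)])
      show "0 \<le> K * (C1 * d ^ 3)" using K C1 d by simp
      fix w assume w: "a \<le> w" "w \<le> b"
      hence "\<bar>w\<bar> \<le> M" using that by auto
      thus "\<bar>binom_cdf_slope n x (cf_quantile n x w) * (d * cf_dev' d (real x / real n) w)
          - K * std_normal_density w\<bar> \<le> K * (C1 * d ^ 3) * inverse (1 + w\<^sup>2)"
        using dens[of w] by simp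
      show "(J has_real_derivative
          binom_cdf_slope n x (cf_quantile n x w) * (d * cf_dev' d (real x / real n) w)) (at w)"
        unfolding J_def d_def by (rule has_real_derivative_binom_cdf_cf_quantile[OF x'])
    qed
    have gauss: "exp (- 2 * real n * (d * y)\<^sup>2) \<le> d ^ 3" if "y \<ge> e / 2 * M" for y
    proof -
      have "(e / 2 * M)\<^sup>2 \<le> y\<^sup>2" using that e M by (intro power_mono) auto
      moreover have "2 * real n * (d * y)\<^sup>2 = 2 * y\<^sup>2" using n by (simp add: d_def power_mult_distrib power_divide)
      moreover have "2 * (e / 2 * M)\<^sup>2 = (e\<^sup>2 / 2 * M) * M" by (simp add: power2_eq_square)
      moreover have "(e\<^sup>2 / 2 * M) * M \<ge> 3 / 2 * M" using n(4) M by (intro mult_right_mono) auto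
      ultimately have "- 2 * real n * (d * y)\<^sup>2 \<le> - (3 / 2) * M" by simp
      thus ?thesis unfolding d3 by simp
    qed
    have half: "1 \<le> e / 2 * M" using n(5) e by (simp add: field_simps)
    have T: "cf_quantile n x w = real x / real n + d * cf_dev d (real x / real n) w" for w
      unfolding cf_quantile_def d_def ..
    have JM: "0 \<le> J (- M)" "J (- M) \<le> d ^ 3" "1 - d ^ 3 \<le> J M" "J M \<le> 1"
    proof -
      define s where "s = sqrt (real x / real n * (1 - real x / real n))"
      have s: "e * M \<le> s * M" using quant[of M] M by (auto simp: s_def)
      have q1: "0 \<le> cf_quantile n x (- M)" "cf_quantile n x (- M) \<le> 1"
          "\<bar>cf_dev d (real x / real n) (- M) - s * (- M)\<bar> \<le> 1"
        using quant[of "- M"] M unfolding s_def by auto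
      have q2: "0 \<le> cf_quantile n x M" "cf_quantile n x M \<le> 1"
          "\<bar>cf_dev d (real x / real n) M - s * M\<bar> \<le> 1"
        using quant[of M] M unfolding s_def by auto
      have y1: "e / 2 * M \<le> - cf_dev d (real x / real n) (- M)" and y2: "e / 2 * M \<le> cf_dev d (real x / real n) M"
        using q1(3) q2(3) s half by (simp_all add: abs_le_iff)
      have le1: "cf_quantile n x (- M) \<le> real x / real n" and le2: "real x / real n \<le> cf_quantile n x M"
        unfolding T using y1 y2 d half by (auto simp: mult_le_0_iff)
      have "J (- M) \<le> exp (- 2 * real n * (real x / real n - cf_quantile n x (- M))\<^sup>2)"
        unfolding J_def by (rule one_minus_binom_cdf_le_exp[OF n(2) le1 q1(1,2)])
      also have "real x / real n - cf_quantile n x (- M) = d * (- cf_dev d (real x / real n) (- M))"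
        unfolding T by simp
      also have "exp (- 2 * real n * (d * (- cf_dev d (real x / real n) (- M)))\<^sup>2) \<le> d ^ 3"
        by (rule gauss[OF y1])
      finally show "J (- M) \<le> d ^ 3" .
      have "1 - J M \<le> exp (- 2 * real n * (cf_quantile n x M - real x / real n)\<^sup>2)"
        using binom_cdf_le_exp[OF n(2) le2 q2(2)] by (simp add: J_def)
      also have "cf_quantile n x M - real x / real n = d * cf_dev d (real x / real n) M"
        unfolding T by simp
      also have "exp (- 2 * real n * (d * cf_dev d (real x / real n) M)\<^sup>2) \<le> d ^ 3"
        by (rule gauss[OF y2])
      finally show "1 - d ^ 3 \<le> J M" by simp
      show "0 \<le> J (- M)"
        using prob_binomial_atMost[OF q1(1,2), of n x] measure_pmf.prob_le_1[of "binomial_pmf n (cf_quantile n x (- M))" "{..x}"]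
        by (simp add: J_def)
      show "J M \<le> 1"
        using prob_binomial_atMost[OF q2(1,2), of n x] measure_nonneg[of "measure_pmf (binomial_pmf n (cf_quantile n x M))" "{..x}"]
        by (simp add: J_def)
    qed
    have PhiM: "Phi (- M) \<le> C2 * d ^ 3" "1 - Phi M \<le> C2 * d ^ 3"
    proof -
      have "exp (- 3 * M) \<le> d ^ 3" unfolding d3 using M by simp
      hence "C2 * exp (- 3 * M) \<le> C2 * d ^ 3" using C2(1) by (intro mult_left_mono) auto
      thus "Phi (- M) \<le> C2 * d ^ 3" "1 - Phi M \<le> C2 * d ^ 3"
        using C2(2)[of "- M"] C2(3)[of M] by auto
    qed
    have full: "\<bar>J M - J (- M) - K * (Phi M - Phi (- M))\<bar> \<le> K * (C1 * d ^ 3) * pi"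
      by (rule incr) (use M in auto)
    \<comment> \<open>The error in \<open>full\<close> is proportional to K, for which no bound is
      known so far. Moving it to the left, with J between 0 and 1 at the ends, bounds K by 2; only
      then do the error terms become free of K.\<close>
    have Kle: "K * (1 - A * d ^ 3) \<le> 1"
    proof -
      have "K * (1 - 2 * C2 * d ^ 3) \<le> K * (Phi M - Phi (- M))"
        using PhiM K by (intro mult_left_mono) auto
      thus ?thesis using full JM by (simp add: A_def algebra_simps abs_le_iff)
    qed
    have "K * (1 / 2) \<le> K * (1 - A * d ^ 3)" using n(3) K by (intro mult_left_mono) auto
    hence K2: "K \<le> 2" using Kle by linarith
    hence KA: "K * X \<le> 2 * X" if "X \<ge> 0" for X using that by (rule mult_right_mono)
    have K3: "\<bar>K - 1\<bar> \<le> (2 * A + 2 * C1 * pi + 2) * d ^ 3"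
    proof -
      have "K \<le> 1 + K * (A * d ^ 3)" using Kle by (simp add: algebra_simps)
      also have "K * (A * d ^ 3) \<le> 2 * (A * d ^ 3)" by (rule KA) (use A d in auto)
      finally have a: "K - 1 \<le> 2 * A * d ^ 3" by simp
      have "K * (Phi M - Phi (- M)) \<le> K * 1"
        using Phi_le_1[of M] Phi_nonneg[of "- M"] K by (intro mult_left_mono) auto
      moreover have "K * (C1 * d ^ 3 * pi) \<le> 2 * (C1 * d ^ 3 * pi)" by (rule KA) (use C1 d in auto)
      ultimately have b: "1 - K \<le> 2 * C1 * pi * d ^ 3 + 2 * d ^ 3"
        using full JM by (simp add: abs_le_iff mult_ac)
      have "A * d ^ 3 \<ge> 0" "C1 * pi * d ^ 3 \<ge> 0" "d ^ 3 \<ge> 0" using A C1 d by auto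
      thus ?thesis using a b unfolding abs_le_iff distrib_right by linarith
    qed
    have w: "\<bar>J w - J (- M) - K * (Phi w - Phi (- M))\<bar> \<le> K * (C1 * d ^ 3 * pi)"
      using incr[of "- M" w] asm(4) by (simp add: M_def mult_ac)
    also have "\<dots> \<le> 2 * (C1 * d ^ 3 * pi)" by (rule KA) (use C1 d in auto)
    finally have w: "\<bar>J w - J (- M) - K * (Phi w - Phi (- M))\<bar> \<le> 2 * C1 * pi * d ^ 3" by (simp add: mult_ac)
    have kp: "0 \<le> K * Phi (- M)" "K * Phi (- M) \<le> 2 * C2 * d ^ 3"
    proof -
      have "K * Phi (- M) \<le> 2 * Phi (- M)" by (rule KA) (rule Phi_nonneg)
      thus "K * Phi (- M) \<le> 2 * C2 * d ^ 3" using PhiM by simp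
    qed (use K Phi_nonneg in simp)
    have "\<bar>(K - 1) * Phi w\<bar> \<le> \<bar>K - 1\<bar> * 1"
      unfolding abs_mult using Phi_nonneg[of w] Phi_le_1[of w] by (intro mult_left_mono) auto
    also have "\<dots> = \<bar>K - 1\<bar>" by simp
    also note K3
    finally have kw: "\<bar>(K - 1) * Phi w\<bar> \<le> (2 * A + 2 * C1 * pi + 2) * d ^ 3" .
    have "J w - Phi w = (J w - J (- M) - K * (Phi w - Phi (- M))) + J (- M) - K * Phi (- M) + (K - 1) * Phi w"
      by (simp add: algebra_simps)
    also have "\<bar>\<dots>\<bar> \<le> 2 * C1 * pi * d ^ 3 + d ^ 3 + 2 * C2 * d ^ 3 + (2 * A + 2 * C1 * pi + 2) * d ^ 3"
      using w kw kp JM(1,2) by linarith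
    also have "\<dots> = C * d ^ 3" by (simp add: C_def algebra_simps)
    finally show ?thesis by (simp add: J_def d_def)
  qed
  moreover have "C > 0" using C1 C2(1) A by (auto simp: C_def intro!: add_pos_pos)
  ultimately show ?thesis using that by blast
qed

section \<open>Inversion: from the distribution function to the endpoint\<close>

lemma (in uniform_expansion) tame_cf_dev': "tame (\<lambda>t. cf_dev' (d t) (P t) (W t))"
  unfolding cf_dev'_def cfA_def cfB_def cfb_def cfa_def
  by (intro tame_intros)

text \<open>Since \<open>cf_quantile\<close> carries a further factor 1 / sqrt n, its slope is of
  order d near a fixed point, which is the power gained when an error in w is carried over to the
  endpoint.\<close>

lemma cf_quantile_slope_bound:
  assumes e: "0 < e"
  obtains C k N where "C > 0"
    "\<And>n x w. n \<ge> N \<Longrightarrow> e * real n \<le> real x \<Longrightarrow> real x \<le> (1 - e) * real n \<Longrightarrow> \<bar>w\<bar> \<le> ln (real n) \<Longrightarrow>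
      \<bar>cf_dev' (1 / sqrt (real n)) (real x / real n) w\<bar> \<le> C * (1 + \<bar>w\<bar>) ^ k"
proof -
  interpret uniform_expansion "central e" "\<lambda>(n, x, w). 1 / sqrt (real n)" "\<lambda>(n, x, w). w"
    "\<lambda>(n, x, w). real x / real n" e
    by (rule uniform_expansion_central[OF e])
  obtain C k where "C > 0" "\<forall>\<^sub>F t in central e. \<bar>cf_dev' (case t of (n, x, w) \<Rightarrow> 1 / sqrt (real n))
      (case t of (n, x, w) \<Rightarrow> real x / real n) (case t of (n, x, w) \<Rightarrow> w)\<bar> \<le> C * (1 + \<bar>case t of (n, x, w) \<Rightarrow> w\<bar>) ^ k"
    by (rule tame_nonneg_const[OF tame_cf_dev'])
  thus ?thesis unfolding eventually_central prod.case using that by blast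
qed

text \<open>On [z - 1, z + 1] the normal density is at least its value at \<bar>z\<bar> + 1.\<close>

lemma Phi_increase:
  obtains m where "m > 0" "\<And>a b. \<bar>z - a\<bar> \<le> 1 \<Longrightarrow> \<bar>z - b\<bar> \<le> 1 \<Longrightarrow> a \<le> b \<Longrightarrow> m * (b - a) \<le> Phi b - Phi a"
proof -
  define m where "m = std_normal_density (\<bar>z\<bar> + 1)"
  have "m * (b - a) \<le> Phi b - Phi a" if ab: "\<bar>z - a\<bar> \<le> 1" "\<bar>z - b\<bar> \<le> 1" "a \<le> b" for a b
  proof -
    have "Phi a - m * a \<le> Phi b - m * b"
    proof (rule DERIV_nonneg_imp_nondecreasing[OF ab(3)])
      fix w assume "a \<le> w" "w \<le> b"
      hence "\<bar>w\<bar> \<le> \<bar>z\<bar> + 1" using ab by arith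
      hence "\<bar>w\<bar>\<^sup>2 \<le> (\<bar>z\<bar> + 1)\<^sup>2" by (intro power_mono) auto
      hence "m \<le> std_normal_density w"
        unfolding m_def std_normal_density_def by (intro mult_left_mono) auto
      moreover have "((\<lambda>w. Phi w - m * w) has_real_derivative std_normal_density w - m * 1) (at w)"
        by (intro DERIV_diff DERIV_cmult DERIV_ident has_real_derivative_Phi)
      ultimately show "\<exists>y. ((\<lambda>w. Phi w - m * w) has_real_derivative y) (at w) \<and> 0 \<le> y"
        by (intro exI[of _ "std_normal_density w - m * 1"]) simp
    qed
    thus ?thesis by (simp add: algebra_simps)
  qed
  moreover have "m > 0" by (simp add: m_def normal_density_pos)
  ultimately show ?thesis using that by blast
qed

text \<open>The endpoint is trapped between T(z - \<eta>) and T(z + \<eta>), with \<eta> of order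
  d^3 chosen so that the change of \<open>Phi\<close> outweighs the approximation error. T is
  Lipschitz with a constant of order d, so both ends differ from T(z) by order d^4.\<close>

lemma cp_upper_expansion:
  assumes e: "0 < e" and \<alpha>: "0 < \<alpha>" "\<alpha> < 1"
  defines "z \<equiv> std_normal_upper_quantile (\<alpha> / 2)"
  obtains C N where "C > 0"
    "\<And>n x. n \<ge> N \<Longrightarrow> e * real n \<le> real x \<Longrightarrow> real x \<le> (1 - e) * real n \<Longrightarrow>
      \<bar>cp_upper n \<alpha> x - cf_quantile n x z\<bar> \<le> C * (1 / sqrt (real n)) ^ 4"
proof -
  have z: "Phi z = 1 - \<alpha> / 2"
    unfolding z_def using \<alpha> by (intro std_normal_upper_quantile) auto
  obtain C1 N1 where C1: "C1 > 0"
    "\<And>n x w. n \<ge> N1 \<Longrightarrow> e * real n \<le> real x \<Longrightarrow> real x \<le> (1 - e) * real n \<Longrightarrow> \<bar>w\<bar> \<le> ln (real n) \<Longrightarrow>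
      \<bar>1 - binom_cdf n x (cf_quantile n x w) - Phi w\<bar> \<le> C1 * (1 / sqrt (real n)) ^ 3"
    by (rule binom_cdf_near_Phi[OF e]) (rule that; assumption)
  obtain C2 k N2 where C2: "C2 > 0"
    "\<And>n x w. n \<ge> N2 \<Longrightarrow> e * real n \<le> real x \<Longrightarrow> real x \<le> (1 - e) * real n \<Longrightarrow> \<bar>w\<bar> \<le> ln (real n) \<Longrightarrow>
      \<bar>cf_dev' (1 / sqrt (real n)) (real x / real n) w\<bar> \<le> C2 * (1 + \<bar>w\<bar>) ^ k"
    by (rule cf_quantile_slope_bound[OF e]) (rule that; assumption)
  obtain N3 where quant:
    "\<And>n x w. n \<ge> N3 \<Longrightarrow> e * real n \<le> real x \<Longrightarrow> real x \<le> (1 - e) * real n \<Longrightarrow> \<bar>w\<bar> \<le> ln (real n) \<Longrightarrow>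
      0 \<le> cf_quantile n x w \<and> cf_quantile n x w \<le> 1"
    by (rule cf_quantile_density[OF e]) (rule that, blast)
  obtain m where m: "m > 0" "\<And>a b. \<bar>z - a\<bar> \<le> 1 \<Longrightarrow> \<bar>z - b\<bar> \<le> 1 \<Longrightarrow> a \<le> b \<Longrightarrow> m * (b - a) \<le> Phi b - Phi a"
    by (rule Phi_increase[of z]) (rule that; assumption)
  \<comment> \<open>A shift by H * d^3 changes \<open>Phi\<close> by at least m * H * d^3 = C1 *
    d^3, just the error of the normal approximation.\<close>
  define H where "H = C1 / m"
  have H: "H > 0" using C1(1) m(1) by (simp add: H_def)
  \<comment> \<open>All points used lie within distance 1 of z, hence 1 + \<bar>w\<bar> \<le> 2 +
    \<bar>z\<bar>.\<close>
  define L where "L = C2 * (2 + \<bar>z\<bar>) ^ k"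
  have L: "L > 0" using C2(1) by (simp add: L_def)
  have "\<forall>\<^sub>F n in sequentially. ln (real n) \<ge> \<bar>z\<bar> + 1" by real_asymp
  moreover have "\<forall>\<^sub>F n in sequentially. H * (1 / sqrt (real n)) ^ 3 \<le> 1" using H by real_asymp
  moreover have "\<forall>\<^sub>F n in sequentially. n \<ge> max (max N1 N2) (max N3 1)" by (rule eventually_ge_at_top)
  ultimately have "\<forall>\<^sub>F n in sequentially. n \<ge> max (max N1 N2) (max N3 1) \<and> H * (1 / sqrt (real n)) ^ 3 \<le> 1
      \<and> ln (real n) \<ge> \<bar>z\<bar> + 1"
    by eventually_elim simp
  then obtain N where N: "\<And>n. n \<ge> N \<Longrightarrow> n \<ge> max (max N1 N2) (max N3 1) \<and> H * (1 / sqrt (real n)) ^ 3 \<le> 1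
      \<and> ln (real n) \<ge> \<bar>z\<bar> + 1"
    unfolding eventually_sequentially by blast
  have "\<bar>cp_upper n \<alpha> x - cf_quantile n x z\<bar> \<le> L * H * (1 / sqrt (real n)) ^ 4"
    if asm: "n \<ge> N" "e * real n \<le> real x" "real x \<le> (1 - e) * real n" for n x
  proof -
    define d where "d = 1 / sqrt (real n)"
    define \<eta> where "\<eta> = H * d ^ 3"
    have n: "n \<ge> N1" "n \<ge> N2" "n \<ge> N3" "n > 0" "\<eta> \<le> 1" "\<bar>z\<bar> + 1 \<le> ln (real n)"
      using N[OF asm(1)] by (auto simp: d_def \<eta>_def)
    have d: "d > 0" using n by (simp add: d_def)
    have \<eta>: "\<eta> > 0" using H d by (simp add: \<eta>_def)
    have m\<eta>: "m * \<eta> = C1 * d ^ 3" using m by (simp add: \<eta>_def H_def)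
    have "(1 - e) * real n < 1 * real n" using n e by (intro mult_strict_right_mono) auto
    hence x': "x < n" using asm(3) by linarith
    have w_le: "\<bar>w\<bar> \<le> ln (real n)" if "\<bar>z - w\<bar> \<le> 1" for w using n that by linarith
    have bound: "\<bar>z - (z + \<eta>)\<bar> \<le> 1" "\<bar>z - (z - \<eta>)\<bar> \<le> 1" using \<eta> n by auto
    have lip: "\<bar>cf_quantile n x b - cf_quantile n x a\<bar> \<le> d * L * (b - a)"
      if ab: "\<bar>z - a\<bar> \<le> 1" "\<bar>z - b\<bar> \<le> 1" "a \<le> b" for a b
    proof -
      have "norm (cf_quantile n x b - cf_quantile n x a) \<le> d * L * norm (b - a)"
      proof (rule field_differentiable_bound[of "{a..b}"])
        fix w assume w: "w \<in> {a..b}"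
        show "(cf_quantile n x has_field_derivative d * cf_dev' d (real x / real n) w) (at w within {a..b})"
          unfolding d_def by (rule DERIV_subset[OF has_real_derivative_cf_quantile]) simp
        have zw: "\<bar>z - w\<bar> \<le> 1" using w ab by auto
        have "\<bar>cf_dev' d (real x / real n) w\<bar> \<le> C2 * (1 + \<bar>w\<bar>) ^ k"
          unfolding d_def by (rule C2(2)[OF n(2) asm(2,3) w_le[OF zw]])
        also have "\<dots> \<le> L" unfolding L_def using C2(1) zw by (intro mult_left_mono power_mono) auto
        finally show "norm (d * cf_dev' d (real x / real n) w) \<le> d * L"
          using d by (simp add: abs_mult)
      qed (use ab in auto)
      thus ?thesis using ab by simp
    qed
    have "C1 * d ^ 3 \<le> Phi (z + \<eta>) - Phi z"
      using m(2)[of z "z + \<eta>"] bound \<eta> m\<eta> by simp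
    hence "binom_cdf n x (cf_quantile n x (z + \<eta>)) \<le> \<alpha> / 2"
      using C1(2)[OF n(1) asm(2,3) w_le[OF bound(1)]] z by (simp add: d_def abs_le_iff)
    hence up: "cp_upper n \<alpha> x \<le> cf_quantile n x (z + \<eta>)"
      using quant[OF n(3) asm(2,3) w_le[OF bound(1)]] by (intro cp_upper_le x' \<alpha>) auto
    have "C1 * d ^ 3 \<le> Phi z - Phi (z - \<eta>)"
      using m(2)[of "z - \<eta>" z] bound \<eta> m\<eta> by simp
    hence "\<alpha> / 2 \<le> binom_cdf n x (cf_quantile n x (z - \<eta>))"
      using C1(2)[OF n(1) asm(2,3) w_le[OF bound(2)]] z by (simp add: d_def abs_le_iff)
    hence lo: "cf_quantile n x (z - \<eta>) \<le> cp_upper n \<alpha> x"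
      using quant[OF n(3) asm(2,3) w_le[OF bound(2)]] by (intro cp_upper_ge x' \<alpha>) auto
    have "\<bar>cf_quantile n x (z + \<eta>) - cf_quantile n x z\<bar> \<le> d * L * \<eta>"
      using lip[of z "z + \<eta>"] bound \<eta> by simp
    moreover have "\<bar>cf_quantile n x z - cf_quantile n x (z - \<eta>)\<bar> \<le> d * L * \<eta>"
      using lip[of "z - \<eta>" z] bound \<eta> by simp
    ultimately have "\<bar>cp_upper n \<alpha> x - cf_quantile n x z\<bar> \<le> d * L * \<eta>"
      using up lo by linarith
    also have "\<dots> = L * H * d ^ 4" by (simp add: \<eta>_def eval_nat_numeral)
    finally show ?thesis by (simp add: d_def)
  qed
  moreover have "L * H > 0" using L H by simp
  ultimately show ?thesis using that by blast
qed

section \<open>Moments and the length of the interval\<close>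

text \<open>Conditioning on one of the Suc n independent trials.\<close>

lemma expectation_binomial_pmf_Suc:
  fixes f :: "nat \<Rightarrow> real"
  assumes p: "p \<in> {0..1}"
  shows "measure_pmf.expectation (binomial_pmf (Suc n) p) f =
     p * measure_pmf.expectation (binomial_pmf n p) (\<lambda>k. f (Suc k))
     + (1 - p) * measure_pmf.expectation (binomial_pmf n p) f"
proof -
  have "measure_pmf.expectation (binomial_pmf (Suc n) p) f =
      measure_pmf.expectation (bernoulli_pmf p \<bind>
        (\<lambda>b. map_pmf (\<lambda>k. (if b then 1 else 0) + k) (binomial_pmf n p))) f"
    by (simp add: binomial_pmf_Suc[OF p] map_pmf_def)
  also have "\<dots> = (\<Sum>b\<in>UNIV. pmf (bernoulli_pmf p) b *\<^sub>R
      measure_pmf.expectation (map_pmf (\<lambda>k. (if b then 1 else 0) + k) (binomial_pmf n p)) f)"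
    by (rule pmf_expectation_bind) (use p in \<open>auto intro!: finite_imageI finite_set_pmf_binomial_pmf\<close>)
  finally show ?thesis using p by (simp add: UNIV_bool)
qed

text \<open>A further trial shifts the centred count by 1 - p or by - p, which gives recursions in n
  by expanding the power.\<close>

lemma binomial_central_moments:
  fixes p :: real and n :: nat
  assumes p: "p \<in> {0..1}"
  defines "m \<equiv> \<lambda>n r. measure_pmf.expectation (binomial_pmf n p) (\<lambda>k. (real k - real n * p) ^ r)"
  shows "m n 1 = 0" "m n 2 = real n * (p * (1 - p))" "m n 4 \<le> 3 * (real n)\<^sup>2"
proof -
  define E where "E = (\<lambda>n. measure_pmf.expectation (binomial_pmf n p) :: (nat \<Rightarrow> real) \<Rightarrow> real)"
  have E_add: "E n (\<lambda>k. f k + g k) = E n f + E n g" and E_mult: "E n (\<lambda>k. c * f k) = c * E n f"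
    and E_const: "E n (\<lambda>k. c) = c" for n f g c
    using p by (simp_all add: E_def)
  have m_E: "m n r = E n (\<lambda>k. (real k - real n * p) ^ r)" for n r by (simp add: m_def E_def)
  have shift: "m (Suc n) r = p * E n (\<lambda>k. ((real k - real n * p) + (1 - p)) ^ r)
      + (1 - p) * E n (\<lambda>k. ((real k - real n * p) + (- p)) ^ r)" for n r
    unfolding m_def E_def expectation_binomial_pmf_Suc[OF p] by (simp add: algebra_simps)
  have e1: "E n (\<lambda>k. ((real k - real n * p) + c) ^ 1) = m n 1 + c" for n c
    by (simp add: m_E E_add E_const)
  have e2: "E n (\<lambda>k. ((real k - real n * p) + c) ^ 2) = m n 2 + 2 * c * m n 1 + c\<^sup>2" for n c
  proof -
    have "E n (\<lambda>k. ((real k - real n * p) + c) ^ 2) =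
        E n (\<lambda>k. (real k - real n * p) ^ 2 + 2 * c * (real k - real n * p) ^ 1 + c\<^sup>2)"
      by (intro arg_cong[where f = "E n"] ext) algebra
    thus ?thesis unfolding m_E by (simp only: E_add E_mult E_const)
  qed
  have e4: "E n (\<lambda>k. ((real k - real n * p) + c) ^ 4) = m n 4 + 4 * c * m n 3 + 6 * c\<^sup>2 * m n 2
      + 4 * c ^ 3 * m n 1 + c ^ 4" for n c
  proof -
    have "E n (\<lambda>k. ((real k - real n * p) + c) ^ 4) =
        E n (\<lambda>k. (real k - real n * p) ^ 4 + 4 * c * (real k - real n * p) ^ 3
          + 6 * c\<^sup>2 * (real k - real n * p) ^ 2 + 4 * c ^ 3 * (real k - real n * p) ^ 1 + c ^ 4)"
      by (intro arg_cong[where f = "E n"] ext) algebra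
    thus ?thesis unfolding m_E by (simp only: E_add E_mult E_const)
  qed
  have rec1: "m (Suc n) 1 = m n 1" for n
    unfolding shift e1 by (simp add: algebra_simps)
  have m1: "m n 1 = 0" for n
  proof (induction n)
    case 0 show ?case using p by (simp add: m_def binomial_pmf_0)
  qed (use rec1 in simp)
  have rec2: "m (Suc n) 2 = m n 2 + p * (1 - p)" for n
    unfolding shift e2 m1 by (simp add: algebra_simps power2_eq_square)
  have m2: "m n 2 = real n * (p * (1 - p))" for n
  proof (induction n)
    case 0 show ?case using p by (simp add: m_def binomial_pmf_0)
  qed (simp add: rec2 algebra_simps)
  \<comment> \<open>The third moment cancels, its two contributions being weighted by 4 * p * (1 -
    p) and its negative. The increment is at most 6 * n + 1, within the growth 6 * n + 3 of 3 *
    n^2.\<close>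
  have rec4: "m (Suc n) 4 = m n 4 + 6 * (p * (1 - p)) * m n 2 + (p * (1 - p) ^ 4 + (1 - p) * p ^ 4)" for n
    unfolding shift e4 m1 by algebra
  have pq: "0 \<le> p * (1 - p)" "p * (1 - p) \<le> 1" using p by (auto intro: mult_le_one)
  have "p * (1 - p) ^ 4 + (1 - p) * p ^ 4 \<le> p * 1 + (1 - p) * 1"
    using p by (intro add_mono mult_left_mono power_le_one) auto
  hence k4: "p * (1 - p) ^ 4 + (1 - p) * p ^ 4 \<le> 1" by simp
  have m4: "m n 4 \<le> 3 * (real n)\<^sup>2" for n
  proof (induction n)
    case 0 show ?case using p by (simp add: m_def binomial_pmf_0)
  next
    case (Suc n)
    have "(p * (1 - p)) * m n 2 = real n * (p * (1 - p))\<^sup>2" by (simp add: m2 power2_eq_square)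
    also have "\<dots> \<le> real n * 1" using pq by (intro mult_left_mono power_le_one) auto
    finally show ?case using Suc.IH k4 by (simp add: rec4 power2_eq_square algebra_simps)
  qed
  show "m n 1 = 0" "m n 2 = real n * (p * (1 - p))" "m n 4 \<le> 3 * (real n)\<^sup>2"
    by (rule m1 m2 m4)+
qed

section \<open>Taylor expansion of the length in the sample proportion\<close>

text \<open>In terms of t = sqrt (1 + u) - 1 the error is exactly t^3 * (4 + t) / 8, while u = t *
  (2 + t) with 2 + t \<ge> 1. This reaches u = - 1, where the square root is not
  differentiable.\<close>

lemma sqrt_taylor2:
  fixes u :: real
  assumes "u \<ge> -1"
  shows "\<bar>sqrt (1 + u) - (1 + u / 2 - u\<^sup>2 / 8)\<bar> \<le> \<bar>u\<bar> ^ 3"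
proof -
  define t where "t = sqrt (1 + u) - 1"
  have t: "t \<ge> -1" using assms by (simp add: t_def)
  have "(1 + t)\<^sup>2 = 1 + u" using assms by (simp add: t_def)
  hence u: "u = t * (2 + t)" by (simp add: power2_eq_square algebra_simps)
  have "sqrt (1 + u) = 1 + t" by (simp add: t_def)
  hence eq: "sqrt (1 + u) - (1 + u / 2 - u\<^sup>2 / 8) = t ^ 3 * ((4 + t) / 8)"
    unfolding u by (simp add: field_simps eval_nat_numeral)
  have "\<bar>sqrt (1 + u) - (1 + u / 2 - u\<^sup>2 / 8)\<bar> = \<bar>t\<bar> ^ 3 * ((4 + t) / 8)"
    unfolding eq abs_mult power_abs using t by simp
  also have "\<dots> \<le> \<bar>t\<bar> ^ 3 * (2 + t) ^ 3"
  proof (rule mult_left_mono)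
    have "(2 + t) ^ 1 \<le> (2 + t) ^ 3" using t by (intro power_increasing) auto
    thus "(4 + t) / 8 \<le> (2 + t) ^ 3" using t by simp
  qed auto
  also have "\<dots> = \<bar>u\<bar> ^ 3" using t by (simp add: u abs_mult power_mult_distrib)
  finally show ?thesis .
qed

text \<open>Writing y * (1 - y) = s^2 * (1 + u) keeps u \<ge> - 1 on all of [0, 1], so the cubic
  bound also covers y = 0 and y = 1.\<close>

lemma sqrt_variance_taylor:
  fixes p :: real
  assumes p: "0 < p" "p < 1"
  defines "s \<equiv> sqrt (p * (1 - p))"
  obtains C where "C > 0" "\<And>y. 0 \<le> y \<Longrightarrow> y \<le> 1 \<Longrightarrow>
     \<bar>sqrt (y * (1 - y)) - (s + (1 - 2 * p) / (2 * s) * (y - p) - 1 / (8 * s ^ 3) * (y - p)\<^sup>2)\<bar> \<le> C * \<bar>y - p\<bar> ^ 3"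
proof -
  have s: "s > 0" "s\<^sup>2 = p * (1 - p)" using p by (auto simp: s_def)
  define C where "C = s * (2 / s\<^sup>2) ^ 3 + 3 / (8 * s ^ 3)"
  have "\<bar>sqrt (y * (1 - y)) - (s + (1 - 2 * p) / (2 * s) * (y - p) - 1 / (8 * s ^ 3) * (y - p)\<^sup>2)\<bar> \<le> C * \<bar>y - p\<bar> ^ 3"
    if y: "0 \<le> y" "y \<le> 1" for y
  proof -
    define h where "h = y - p"
    define v where "v = (1 - 2 * p) * h - h\<^sup>2"
    define u where "u = v / s\<^sup>2"
    have h: "\<bar>h\<bar> \<le> 1" using y p by (auto simp: h_def)
    have yy: "y * (1 - y) = s\<^sup>2 * (1 + u)"
    proof -
      have "s\<^sup>2 * (1 + u) = s\<^sup>2 + v" using s(1) by (simp add: u_def field_simps)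
      thus ?thesis unfolding s(2) v_def h_def by (simp add: algebra_simps power2_eq_square)
    qed
    have u1: "u \<ge> -1"
    proof -
      have "0 \<le> s\<^sup>2 * (1 + u)" unfolding yy[symmetric] using y by simp
      thus ?thesis using s(1) by (simp add: zero_le_mult_iff)
    qed
    have sq: "sqrt (y * (1 - y)) = s * sqrt (1 + u)"
      unfolding yy using s(1) by (simp add: real_sqrt_mult)
    have "\<bar>v\<bar> \<le> 2 * \<bar>h\<bar>"
    proof -
      have "v = h * (1 - 2 * p - h)" by (simp add: v_def power2_eq_square algebra_simps)
      moreover have "\<bar>1 - 2 * p - h\<bar> \<le> 2" using y p by (auto simp: h_def)
      ultimately show ?thesis
        using mult_left_mono[of "\<bar>1 - 2 * p - h\<bar>" 2 "\<bar>h\<bar>"] by (simp add: abs_mult)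
    qed
    hence "\<bar>u\<bar> \<le> 2 / s\<^sup>2 * \<bar>h\<bar>" using s(1) by (simp add: u_def divide_right_mono)
    hence "\<bar>u\<bar> ^ 3 \<le> (2 / s\<^sup>2 * \<bar>h\<bar>) ^ 3" by (intro power_mono) auto
    hence u3: "s * \<bar>u\<bar> ^ 3 \<le> s * ((2 / s\<^sup>2) ^ 3 * \<bar>h\<bar> ^ 3)"
      using s(1) unfolding power_mult_distrib by (intro mult_left_mono) auto
    have "\<bar>s * sqrt (1 + u) - s * (1 + u / 2 - u\<^sup>2 / 8)\<bar> = s * \<bar>sqrt (1 + u) - (1 + u / 2 - u\<^sup>2 / 8)\<bar>"
      using s(1) by (simp add: abs_mult right_diff_distrib[symmetric] del: right_diff_distrib)
    also have "\<dots> \<le> s * \<bar>u\<bar> ^ 3" using s(1) sqrt_taylor2[OF u1] by (intro mult_left_mono) auto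
    finally have b1: "\<bar>s * sqrt (1 + u) - s * (1 + u / 2 - u\<^sup>2 / 8)\<bar> \<le> s * (2 / s\<^sup>2) ^ 3 * \<bar>h\<bar> ^ 3"
      using u3 by (simp add: mult_ac)
    have "s * (1 + u / 2 - u\<^sup>2 / 8) = s + v / (2 * s) - v\<^sup>2 / (8 * s ^ 3)"
      using s(1) by (simp add: u_def field_simps eval_nat_numeral)
    \<comment> \<open>Here (1 - 2 * p)^2 = 1 - 4 * s^2. Combined with the term - h^2 / (2 * s) from
      v, the quadratic coefficient collapses to - 1 / (8 * s^3).\<close>
    also have "v\<^sup>2 = (1 - 4 * s\<^sup>2) * h\<^sup>2 + h ^ 3 * (h - 2 * (1 - 2 * p))"
      unfolding s(2) v_def by (simp add: algebra_simps eval_nat_numeral)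
    also have "s + v / (2 * s) - ((1 - 4 * s\<^sup>2) * h\<^sup>2 + h ^ 3 * (h - 2 * (1 - 2 * p))) / (8 * s ^ 3) =
       (s + (1 - 2 * p) / (2 * s) * h - 1 / (8 * s ^ 3) * h\<^sup>2) - h ^ 3 * (h - 2 * (1 - 2 * p)) / (8 * s ^ 3)"
      using s(1) by (simp add: v_def field_simps eval_nat_numeral)
    finally have eq: "s * (1 + u / 2 - u\<^sup>2 / 8) =
       (s + (1 - 2 * p) / (2 * s) * h - 1 / (8 * s ^ 3) * h\<^sup>2) - h ^ 3 * (h - 2 * (1 - 2 * p)) / (8 * s ^ 3)" .
    have "\<bar>h - 2 * (1 - 2 * p)\<bar> \<le> 3" using h p by auto
    hence "\<bar>h\<bar> ^ 3 * \<bar>h - 2 * (1 - 2 * p)\<bar> / (8 * s ^ 3) \<le> \<bar>h\<bar> ^ 3 * 3 / (8 * s ^ 3)"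
      using s(1) by (intro divide_right_mono mult_left_mono) auto
    hence b2: "\<bar>h ^ 3 * (h - 2 * (1 - 2 * p)) / (8 * s ^ 3)\<bar> \<le> 3 / (8 * s ^ 3) * \<bar>h\<bar> ^ 3"
      using s(1) by (simp add: abs_mult power_abs mult_ac)
    show ?thesis
      using b1 b2 unfolding sq eq h_def[symmetric] C_def distrib_right by linarith
  qed
  moreover have "C > 0" using s(1) by (auto simp: C_def intro!: add_pos_pos)
  ultimately show ?thesis using that by blast
qed

text \<open>
  The terms of order \<open>1 / n\<close> in the two endpoints add up to exactly \<open>1 / n\<close>; \<open>cf_len\<close> collects those of
  order \<open>n\<close> to the power \<open>- 3 / 2\<close>.
\<close>

definition cf_len :: "real \<Rightarrow> real \<Rightarrow> real" where
  "cf_len P z = z / 18 * ((2 + z\<^sup>2) / sqrt (P * (1 - P)) - (17 + 13 * z\<^sup>2) * sqrt (P * (1 - P)))"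

text \<open>The leading terms coincide under exchange of P and 1 - P, whereas \<open>cfB\<close> is
  antisymmetric; so at order d the dependence on z disappears from the sum.\<close>

lemma cf_dev_symmetric:
  assumes "0 < P" "P < 1"
  shows "cf_dev d P z + cf_dev d (1 - P) z = 2 * z * sqrt (P * (1 - P)) + d + d\<^sup>2 * cf_len P z"
proof -
  define s where "s = sqrt (P * (1 - P))"
  have s: "s > 0" "s\<^sup>2 = P * (1 - P)" using assms by (auto simp: s_def)
  have "cfA P + cfA (1 - P) = 1" "cfB P + cfB (1 - P) = 0" by (simp_all add: cfA_def cfB_def field_simps)
  moreover have "cf1 P z + cf1 (1 - P) z = (cfA P + cfA (1 - P)) + (cfB P + cfB (1 - P)) * z\<^sup>2"
    by (simp add: cf1_def algebra_simps)
  ultimately have 1: "cf1 P z + cf1 (1 - P) z = 1" by simp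
  have ab: "cfa P + cfa (1 - P) = (2 - 17 * (P * (1 - P))) / 18" "cfb P + cfb (1 - P) = (1 - 13 * (P * (1 - P))) / 18"
    by (simp_all add: cfa_def cfb_def cfA_def cfB_def power2_eq_square field_simps)
  have "cf2 P z + cf2 (1 - P) z = ((cfa P + cfa (1 - P)) * z + (cfb P + cfb (1 - P)) * z ^ 3) / s"
    by (simp add: cf2_def mult.commute[of "1 - P" P] add_divide_distrib distrib_right flip: s_def)
  also have "\<dots> = ((2 - 17 * s\<^sup>2) / 18 * z + (1 - 13 * s\<^sup>2) / 18 * z ^ 3) / s" unfolding ab s(2) ..
  also have "\<dots> = cf_len P z"
    using s(1) unfolding cf_len_def s_def[symmetric]
    by (simp add: field_simps eval_nat_numeral)
  finally have 2: "cf2 P z + cf2 (1 - P) z = cf_len P z" .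
  have "cf_dev d P z + cf_dev d (1 - P) z = 2 * z * sqrt (P * (1 - P)) + d * (cf1 P z + cf1 (1 - P) z) + d\<^sup>2 * (cf2 P z + cf2 (1 - P) z)"
    by (simp add: cf_dev_def mult.commute[of "1 - P" P] distrib_left)
  thus ?thesis unfolding 1 2 by simp
qed

text \<open>The range of x is invariant under the reflection to n - x, so the expansion of the upper
  endpoint applies at both counts and the errors add.\<close>

lemma cp_length_expansion:
  assumes e: "0 < e" and \<alpha>: "0 < \<alpha>" "\<alpha> < 1"
  defines "z \<equiv> std_normal_upper_quantile (\<alpha> / 2)"
  obtains C N where "C > 0"
    "\<And>n x. n \<ge> N \<Longrightarrow> e * real n \<le> real x \<Longrightarrow> real x \<le> (1 - e) * real n \<Longrightarrow>
      \<bar>cp_length n \<alpha> x - (2 * z * (1 / sqrt (real n)) * sqrt (real x / real n * (1 - real x / real n))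
        + (1 / sqrt (real n))\<^sup>2 + (1 / sqrt (real n)) ^ 3 * cf_len (real x / real n) z)\<bar> \<le> C * (1 / sqrt (real n)) ^ 4"
proof -
  obtain C N where C: "C > 0"
    "\<And>n x. n \<ge> N \<Longrightarrow> e * real n \<le> real x \<Longrightarrow> real x \<le> (1 - e) * real n \<Longrightarrow>
      \<bar>cp_upper n \<alpha> x - cf_quantile n x z\<bar> \<le> C * (1 / sqrt (real n)) ^ 4"
    by (rule cp_upper_expansion[OF e \<alpha>, folded z_def]) (rule that; assumption)
  have "\<bar>cp_length n \<alpha> x - (2 * z * (1 / sqrt (real n)) * sqrt (real x / real n * (1 - real x / real n))
        + (1 / sqrt (real n))\<^sup>2 + (1 / sqrt (real n)) ^ 3 * cf_len (real x / real n) z)\<bar>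
      \<le> 2 * C * (1 / sqrt (real n)) ^ 4"
    if asm: "n \<ge> max N 1" "e * real n \<le> real x" "real x \<le> (1 - e) * real n" for n x
  proof -
    define d where "d = 1 / sqrt (real n)"
    define P where "P = real x / real n"
    have n: "n \<ge> N" "n > 0" using asm(1) by auto
    have "0 < e * real n" using n e by simp
    hence x: "0 < x" using asm(2) by linarith
    have "(1 - e) * real n < 1 * real n" using n e by (intro mult_strict_right_mono) auto
    hence x': "x < n" using asm(3) by linarith
    have P: "0 < P" "P < 1" using x x' by (auto simp: P_def)
    have P': "real (n - x) / real n = 1 - P" using x' by (simp add: P_def of_nat_diff diff_divide_distrib)
    have asm': "e * real n \<le> real (n - x)" "real (n - x) \<le> (1 - e) * real n"
      using asm(2,3) x' by (simp_all add: of_nat_diff algebra_simps)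
    have len: "cp_length n \<alpha> x = cp_upper n \<alpha> x + cp_upper n \<alpha> (n - x) - 1"
      using cp_lower_eq_cp_upper[of x n \<alpha>] x' n \<alpha> by (simp add: cp_length_def)
    have "cf_quantile n x z + cf_quantile n (n - x) z - 1 = d * (cf_dev d P z + cf_dev d (1 - P) z)"
      unfolding cf_quantile_def P' unfolding P_def[symmetric] d_def[symmetric] by (simp add: algebra_simps)
    also have "\<dots> = 2 * z * d * sqrt (P * (1 - P)) + d\<^sup>2 + d ^ 3 * cf_len P z"
      unfolding cf_dev_symmetric[OF P] by (simp only: algebra_simps power2_eq_square power3_eq_cube)
    finally have "cp_length n \<alpha> x - (2 * z * d * sqrt (P * (1 - P)) + d\<^sup>2 + d ^ 3 * cf_len P z)
        = (cp_upper n \<alpha> x - cf_quantile n x z) + (cp_upper n \<alpha> (n - x) - cf_quantile n (n - x) z)"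
      using len by linarith
    also have "\<bar>\<dots>\<bar> \<le> C * d ^ 4 + C * d ^ 4"
      using C(2)[OF n(1) asm(2,3), folded d_def] C(2)[OF n(1) asm', folded d_def] by linarith
    finally show ?thesis unfolding d_def P_def by simp
  qed
  thus ?thesis using C(1) by (intro that[of "2 * C" "max N 1"]) auto
qed

text \<open>The difference of square roots is the difference of their squares divided by their sum.
  Keeping both points at distance e from 0 and 1 bounds the square roots below by e.\<close>

lemma cf_len_lipschitz:
  fixes e :: real
  assumes e: "0 < e"
  obtains C where "C > 0" "\<And>p y. e \<le> p \<Longrightarrow> p \<le> 1 - e \<Longrightarrow> e \<le> y \<Longrightarrow> y \<le> 1 - e \<Longrightarrow>
    \<bar>cf_len y z - cf_len p z\<bar> \<le> C * \<bar>y - p\<bar>"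
proof -
  \<comment> \<open>The final + 1 only keeps C positive when z = 0.\<close>
  define C where "C = \<bar>z\<bar> / 18 * ((2 + z\<^sup>2) * (2 / e ^ 3) + (17 + 13 * z\<^sup>2) * (2 / e)) + 1"
  have "\<bar>cf_len y z - cf_len p z\<bar> \<le> C * \<bar>y - p\<bar>" if yp: "e \<le> p" "p \<le> 1 - e" "e \<le> y" "y \<le> 1 - e" for p y
  proof -
    define s where "s = sqrt (p * (1 - p))"
    define g where "g = sqrt (y * (1 - y))"
    have sqrt_ge: "e \<le> sqrt (t * (1 - t))" if "e \<le> t" "t \<le> 1 - e" for t
    proof -
      have "e * e \<le> t * (1 - t)" using that e by (intro mult_mono) auto
      thus ?thesis using e by (simp add: real_le_rsqrt power2_eq_square)
    qed
    have s: "e \<le> s" "s\<^sup>2 = p * (1 - p)" using sqrt_ge[of p] yp e by (auto simp: s_def)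
    have g: "e \<le> g" "g\<^sup>2 = y * (1 - y)" using sqrt_ge[of y] yp e by (auto simp: g_def)
    have "(g - s) * (g + s) = (y - p) * (1 - p - y)"
      using s(2) g(2) by (simp add: power2_eq_square algebra_simps)
    hence "\<bar>g - s\<bar> * (g + s) = \<bar>y - p\<bar> * \<bar>1 - p - y\<bar>"
      using s(1) g(1) e by (metis abs_mult abs_of_pos add_pos_pos less_le_trans)
    also have "\<dots> \<le> \<bar>y - p\<bar> * 2" using yp e by (intro mult_left_mono) auto
    finally have "\<bar>g - s\<bar> * (g + s) \<le> \<bar>y - p\<bar> * 2" .
    moreover have "\<bar>g - s\<bar> * e \<le> \<bar>g - s\<bar> * (g + s)" using s(1) g(1) e by (intro mult_left_mono) auto
    ultimately have "\<bar>g - s\<bar> * e \<le> 2 * \<bar>y - p\<bar>" by linarith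
    hence d1: "\<bar>g - s\<bar> \<le> 2 / e * \<bar>y - p\<bar>" using e by (simp add: field_simps)
    have d2: "\<bar>1 / g - 1 / s\<bar> \<le> 2 / e ^ 3 * \<bar>y - p\<bar>"
    proof -
      have pos: "g > 0" "s > 0" using s(1) g(1) e by auto
      have "1 / g - 1 / s = (s - g) / (g * s)" using pos by (simp add: field_simps)
      hence "\<bar>1 / g - 1 / s\<bar> = \<bar>g - s\<bar> / (g * s)" using pos by (simp add: abs_minus_commute)
      also have "\<dots> \<le> (2 / e * \<bar>y - p\<bar>) / (e * e)"
        using d1 s(1) g(1) e by (intro frac_le mult_mono) auto
      also have "\<dots> = 2 / e ^ 3 * \<bar>y - p\<bar>" by (simp add: power3_eq_cube)
      finally show ?thesis .
    qed
    have "cf_len y z - cf_len p z = z / 18 * ((2 + z\<^sup>2) * (1 / g - 1 / s) - (17 + 13 * z\<^sup>2) * (g - s))"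
      unfolding cf_len_def s_def[symmetric] g_def[symmetric] by (simp add: algebra_simps add_divide_distrib)
    also have "\<bar>\<dots>\<bar> \<le> \<bar>z\<bar> / 18 * (\<bar>(2 + z\<^sup>2) * (1 / g - 1 / s)\<bar> + \<bar>(17 + 13 * z\<^sup>2) * (g - s)\<bar>)"
      unfolding abs_mult by (intro mult_mono order_trans[OF abs_triangle_ineq4]) (auto simp: abs_mult)
    also have "\<dots> \<le> \<bar>z\<bar> / 18 * ((2 + z\<^sup>2) * (2 / e ^ 3 * \<bar>y - p\<bar>) + (17 + 13 * z\<^sup>2) * (2 / e * \<bar>y - p\<bar>))"
      unfolding abs_mult using d1 d2 by (intro mult_left_mono add_mono mult_mono) auto
    also have "\<dots> = (C - 1) * \<bar>y - p\<bar>" by (simp add: C_def algebra_simps)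
    also have "\<dots> \<le> C * \<bar>y - p\<bar>" by (intro mult_right_mono) auto
    finally show ?thesis .
  qed
  moreover have "C > 0" using e unfolding C_def by (intro add_nonneg_pos mult_nonneg_nonneg add_nonneg_nonneg) auto
  ultimately show ?thesis using that by blast
qed

text \<open>Applied in both directions, it absorbs the mixed errors d * \<bar>h\<bar>^3 from the
  square root and d^3 * \<bar>h\<bar> from \<open>cf_len\<close> into d^4 + h^4, so that no odd
  absolute moment has to be estimated.\<close>

lemma mult_power3_le:
  fixes a b :: real
  assumes "0 \<le> a" "0 \<le> b"
  shows "a * b ^ 3 \<le> a ^ 4 + b ^ 4" 
proof (cases "a \<le> b")
  case True
  have "a * b ^ 3 \<le> b * b ^ 3" using True assms by (intro mult_right_mono) auto
  also have "b * b ^ 3 = b ^ 4" by (simp add: eval_nat_numeral)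
  finally show ?thesis by (rule order_trans) simp
next
  case False
  have "a * b ^ 3 \<le> a * a ^ 3" using False assms by (intro mult_left_mono power_mono) auto
  also have "a * a ^ 3 = a ^ 4" by (simp add: eval_nat_numeral)
  finally show ?thesis by (rule order_trans) simp
qed

lemma cp_length_taylor:
  assumes p: "0 < p" "p < 1" and \<alpha>: "0 < \<alpha>" "\<alpha> < 1"
  defines "z \<equiv> std_normal_upper_quantile (\<alpha> / 2)" and "s \<equiv> sqrt (p * (1 - p))"
  obtains C N where "C > 0"
    "\<And>n x. n \<ge> N \<Longrightarrow> x \<le> n \<Longrightarrow>
      \<bar>cp_length n \<alpha> x - (2 * z * (1 / sqrt (real n)) *
          (s + (1 - 2 * p) / (2 * s) * (real x / real n - p) - 1 / (8 * s ^ 3) * (real x / real n - p)\<^sup>2)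
        + (1 / sqrt (real n))\<^sup>2 + (1 / sqrt (real n)) ^ 3 * cf_len p z)\<bar>
      \<le> C * ((1 / sqrt (real n)) ^ 4 + (real x / real n - p) ^ 4)"
proof -
  \<comment> \<open>Half the distance from p to the boundary: a proportion outside [e, 1 - e]
    differs from p by at least e.\<close>
  define e where "e = min p (1 - p) / 2"
  have e: "0 < e" "2 * e \<le> p" "p \<le> 1 - 2 * e" using p by (auto simp: e_def min_def)
  have s: "s > 0" using p by (simp add: s_def)
  define G where "G = (1 - 2 * p) / (2 * s)"
  define G' where "G' = 1 / (8 * s ^ 3)"
  obtain C1 N1 where C1: "C1 > 0" "\<And>n x. n \<ge> N1 \<Longrightarrow> e * real n \<le> real x \<Longrightarrow> real x \<le> (1 - e) * real n \<Longrightarrow>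
      \<bar>cp_length n \<alpha> x - (2 * z * (1 / sqrt (real n)) * sqrt (real x / real n * (1 - real x / real n))
        + (1 / sqrt (real n))\<^sup>2 + (1 / sqrt (real n)) ^ 3 * cf_len (real x / real n) z)\<bar> \<le> C1 * (1 / sqrt (real n)) ^ 4"
    by (rule cp_length_expansion[OF e(1) \<alpha>, folded z_def]) (rule that; assumption)
  obtain C2 where C2: "C2 > 0" "\<And>y. 0 \<le> y \<Longrightarrow> y \<le> 1 \<Longrightarrow>
     \<bar>sqrt (y * (1 - y)) - (s + G * (y - p) - G' * (y - p)\<^sup>2)\<bar> \<le> C2 * \<bar>y - p\<bar> ^ 3"
    by (rule sqrt_variance_taylor[OF p, folded s_def, folded G_def G'_def]) (rule that; assumption)
  obtain C3 where C3: "C3 > 0" "\<And>p y. e \<le> p \<Longrightarrow> p \<le> 1 - e \<Longrightarrow> e \<le> y \<Longrightarrow> y \<le> 1 - e \<Longrightarrow>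
    \<bar>cf_len y z - cf_len p z\<bar> \<le> C3 * \<bar>y - p\<bar>"
    by (rule cf_len_lipschitz[OF e(1)]) (rule that; assumption)
  define B where "B = 2 * \<bar>z\<bar> * (s + \<bar>G\<bar> + \<bar>G'\<bar>) + 1 + \<bar>cf_len p z\<bar>"
  have "0 \<le> 2 * \<bar>z\<bar> * (s + \<bar>G\<bar> + \<bar>G'\<bar>)" using s by (intro mult_nonneg_nonneg) auto
  hence B: "B > 0" unfolding B_def by linarith
  \<comment> \<open>The first three terms serve proportions in [e, 1 - e]. Outside, the length is at
    most 1, the polynomial at most B, and h^4 at least e^4, which gives the last term.\<close>
  define C where "C = C1 + 2 * \<bar>z\<bar> * C2 + C3 + (1 + B) / e ^ 4"
  have C: "C > 0" "C \<ge> C1 + 2 * \<bar>z\<bar> * C2 + C3" "C \<ge> (1 + B) / e ^ 4"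
    using C1(1) C2(1) C3(1) e(1) B by (auto simp: C_def intro!: add_pos_pos add_pos_nonneg)
  have "\<bar>cp_length n \<alpha> x - (2 * z * (1 / sqrt (real n)) *
          (s + G * (real x / real n - p) - G' * (real x / real n - p)\<^sup>2)
        + (1 / sqrt (real n))\<^sup>2 + (1 / sqrt (real n)) ^ 3 * cf_len p z)\<bar>
      \<le> C * ((1 / sqrt (real n)) ^ 4 + (real x / real n - p) ^ 4)"
    if asm: "n \<ge> max N1 1" "x \<le> n" for n x
  proof -
    define d where "d = 1 / sqrt (real n)"
    define y where "y = real x / real n"
    define h where "h = y - p"
    have n: "n \<ge> N1" "n > 0" using asm by auto
    have d: "0 < d" "d \<le> 1" using n(2) by (auto simp: d_def)
    have y: "0 \<le> y" "y \<le> 1" using asm(2) n(2) by (auto simp: y_def)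
    have h: "\<bar>h\<bar> \<le> 1" using y p by (auto simp: h_def)
    have h4: "0 \<le> h ^ 4" by simp
    show ?thesis
    proof (cases "e \<le> y \<and> y \<le> 1 - e")
      case True
      hence c: "e * real n \<le> real x" "real x \<le> (1 - e) * real n"
        using n(2) by (simp_all add: y_def field_simps)
      have b1: "\<bar>cp_length n \<alpha> x - (2 * z * d * sqrt (y * (1 - y)) + d\<^sup>2 + d ^ 3 * cf_len y z)\<bar> \<le> C1 * d ^ 4"
        using C1(2)[OF n(1) c] unfolding d_def y_def .
      have b2: "\<bar>2 * z * d * (sqrt (y * (1 - y)) - (s + G * h - G' * h\<^sup>2))\<bar> \<le> 2 * \<bar>z\<bar> * C2 * (d ^ 4 + h ^ 4)"
      proof -
        have "\<bar>2 * z * d * (sqrt (y * (1 - y)) - (s + G * h - G' * h\<^sup>2))\<bar> =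
           2 * \<bar>z\<bar> * d * \<bar>sqrt (y * (1 - y)) - (s + G * h - G' * h\<^sup>2)\<bar>"
          using d by (simp add: abs_mult)
        also have "\<dots> \<le> 2 * \<bar>z\<bar> * d * (C2 * \<bar>h\<bar> ^ 3)"
          using C2(2)[OF y] d unfolding h_def by (intro mult_left_mono) auto
        also have "\<dots> = 2 * \<bar>z\<bar> * C2 * (d * \<bar>h\<bar> ^ 3)" by simp
        also have "\<dots> \<le> 2 * \<bar>z\<bar> * C2 * (d ^ 4 + \<bar>h\<bar> ^ 4)"
          using C2(1) d by (intro mult_left_mono mult_power3_le) auto
        finally show ?thesis by simp
      qed
      have b3: "\<bar>d ^ 3 * (cf_len y z - cf_len p z)\<bar> \<le> C3 * (d ^ 4 + h ^ 4)"
      proof -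
        have "\<bar>d ^ 3 * (cf_len y z - cf_len p z)\<bar> = d ^ 3 * \<bar>cf_len y z - cf_len p z\<bar>"
          using d by (simp add: abs_mult)
        also have "\<dots> \<le> d ^ 3 * (C3 * \<bar>h\<bar>)"
          using C3(2)[of p y] True e d unfolding h_def by (intro mult_left_mono) auto
        also have "\<dots> = C3 * (\<bar>h\<bar> * d ^ 3)" by simp
        also have "\<dots> \<le> C3 * (\<bar>h\<bar> ^ 4 + d ^ 4)"
          using C3(1) d by (intro mult_left_mono mult_power3_le) auto
        finally show ?thesis by (simp add: add.commute)
      qed
      have "cp_length n \<alpha> x - (2 * z * d * (s + G * h - G' * h\<^sup>2) + d\<^sup>2 + d ^ 3 * cf_len p z)
         = (cp_length n \<alpha> x - (2 * z * d * sqrt (y * (1 - y)) + d\<^sup>2 + d ^ 3 * cf_len y z))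
           + 2 * z * d * (sqrt (y * (1 - y)) - (s + G * h - G' * h\<^sup>2)) + d ^ 3 * (cf_len y z - cf_len p z)"
        by (simp add: right_diff_distrib)
      also have "\<bar>\<dots>\<bar> \<le> C1 * d ^ 4 + 2 * \<bar>z\<bar> * C2 * (d ^ 4 + h ^ 4) + C3 * (d ^ 4 + h ^ 4)"
        using b1 b2 b3 by linarith
      also have "\<dots> \<le> (C1 + 2 * \<bar>z\<bar> * C2 + C3) * (d ^ 4 + h ^ 4)"
        using C1(1) h4 by (simp add: algebra_simps)
      also have "\<dots> \<le> C * (d ^ 4 + h ^ 4)"
        using C(2) d h4 by (intro mult_right_mono add_nonneg_nonneg) auto
      finally show ?thesis unfolding h_def y_def d_def .
    next
      case False
      hence "e \<le> \<bar>h\<bar>" using e by (auto simp: h_def)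
      hence "e ^ 4 \<le> \<bar>h\<bar> ^ 4" using e by (intro power_mono) auto
      hence eh: "e ^ 4 \<le> h ^ 4" by simp
      have len: "\<bar>cp_length n \<alpha> x\<bar> \<le> 1"
        using cp_lower_eq_cp_upper[of x n \<alpha>] cp_upper_bounds[of x n \<alpha>] cp_upper_bounds[of "n - x" n \<alpha>] asm(2) n(2) \<alpha>
        by (simp add: cp_length_def abs_le_iff)
      have poly: "\<bar>2 * z * d * (s + G * h - G' * h\<^sup>2) + d\<^sup>2 + d ^ 3 * cf_len p z\<bar> \<le> B"
      proof -
        have "\<bar>G * h\<bar> \<le> \<bar>G\<bar> * 1" "\<bar>G' * h\<^sup>2\<bar> \<le> \<bar>G'\<bar> * 1"
          using h by (auto simp: abs_mult abs_square_le_1 intro!: mult_left_mono mult_left_le)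
        hence i: "\<bar>s + G * h - G' * h\<^sup>2\<bar> \<le> s + \<bar>G\<bar> + \<bar>G'\<bar>" using s by linarith
        have "\<bar>2 * z * d * (s + G * h - G' * h\<^sup>2)\<bar> = 2 * \<bar>z\<bar> * (d * \<bar>s + G * h - G' * h\<^sup>2\<bar>)"
          using d by (simp add: abs_mult)
        also have "\<dots> \<le> 2 * \<bar>z\<bar> * (1 * (s + \<bar>G\<bar> + \<bar>G'\<bar>))"
          using d i by (intro mult_left_mono mult_mono) auto
        finally have 1: "\<bar>2 * z * d * (s + G * h - G' * h\<^sup>2)\<bar> \<le> 2 * \<bar>z\<bar> * (s + \<bar>G\<bar> + \<bar>G'\<bar>)" by simp
        have "d ^ 3 * \<bar>cf_len p z\<bar> \<le> 1 * \<bar>cf_len p z\<bar>"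
          using d by (intro mult_right_mono power_le_one) auto
        hence 2: "\<bar>d ^ 3 * cf_len p z\<bar> \<le> \<bar>cf_len p z\<bar>" using d by (simp add: abs_mult)
        have 3: "\<bar>d\<^sup>2\<bar> \<le> 1" using d by (simp add: power_le_one)
        show ?thesis unfolding B_def using 1 2 3 by linarith
      qed
      have "\<bar>cp_length n \<alpha> x - (2 * z * d * (s + G * h - G' * h\<^sup>2) + d\<^sup>2 + d ^ 3 * cf_len p z)\<bar> \<le> 1 + B"
        using len poly by linarith
      also have "1 + B = (1 + B) / e ^ 4 * e ^ 4" using e by simp
      also have "\<dots> \<le> C * (d ^ 4 + h ^ 4)"
        using C eh d e by (intro mult_mono) (auto simp: add_nonneg_nonneg intro: order_trans[OF eh])
      finally show ?thesis unfolding h_def y_def d_def .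
    qed
  qed
  thus ?thesis using C(1) by (intro that[of C "max N1 1"]) (auto simp: G_def G'_def)
qed

section \<open>Expectation of the length\<close>

theorem theorem2:
  fixes p \<alpha> q z :: real
  assumes "0 < p" "p < 1" and "0 < \<alpha>" "\<alpha> < 1"
  defines "q \<equiv> 1 - p"
    and "z \<equiv> std_normal_upper_quantile (\<alpha> / 2)"
  shows "(\<lambda>n. measure_pmf.expectation (binomial_pmf n p) (\<lambda>x. cp_length n \<alpha> x)
           - (2 * z * real n powr (-1/2) * (p * q) powr (1/2)
              + real n powr (-1)
              + real n powr (-3/2) * (p * q) powr (-1/2) * (z / 18)
                * (z\<^sup>2 - 5/2 - 17 * p * q - 13 * p * q * z\<^sup>2)))
         \<in> O(\<lambda>n. real n powr (-2))"
proof -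
  define s where "s = sqrt (p * (1 - p))"
  define G where "G = (1 - 2 * p) / (2 * s)"
  define G' where "G' = 1 / (8 * s ^ 3)"
  have s: "s > 0" "s\<^sup>2 = p * q" using assms(1,2) by (auto simp: s_def q_def)
  have p01: "p \<in> {0..1}" using assms(1,2) by simp
  obtain C N where C: "C > 0" "\<And>n x. n \<ge> N \<Longrightarrow> x \<le> n \<Longrightarrow>
      \<bar>cp_length n \<alpha> x - (2 * z * (1 / sqrt (real n)) *
          (s + G * (real x / real n - p) - G' * (real x / real n - p)\<^sup>2)
        + (1 / sqrt (real n))\<^sup>2 + (1 / sqrt (real n)) ^ 3 * cf_len p z)\<bar>
      \<le> C * ((1 / sqrt (real n)) ^ 4 + (real x / real n - p) ^ 4)"
    by (rule cp_length_taylor[OF assms(1-4), folded z_def s_def, folded G_def G'_def]) (rule that; assumption)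
  have "\<bar>measure_pmf.expectation (binomial_pmf n p) (\<lambda>x. cp_length n \<alpha> x)
           - (2 * z * real n powr (-1/2) * (p * q) powr (1/2)
              + real n powr (-1)
              + real n powr (-3/2) * (p * q) powr (-1/2) * (z / 18)
                * (z\<^sup>2 - 5/2 - 17 * p * q - 13 * p * q * z\<^sup>2))\<bar> \<le> (4 * C) * real n powr (-2)"
    if n: "n \<ge> max N 1" for n
  proof -
    define d where "d = 1 / sqrt (real n)"
    define E where "E = (measure_pmf.expectation (binomial_pmf n p) :: (nat \<Rightarrow> real) \<Rightarrow> real)"
    define h where "h = (\<lambda>x. real x / real n - p)"
    have n': "n \<ge> N" "n > 0" using n by auto
    have d: "d > 0" using n' by (simp add: d_def)
    have d2: "d\<^sup>2 = 1 / real n" using n' by (simp add: d_def power_divide)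
    have E_add: "E (\<lambda>k. f k + g k) = E f + E g" and E_diff: "E (\<lambda>k. f k - g k) = E f - E g"
      and E_mult: "E (\<lambda>k. c * f k) = c * E f" and E_const: "E (\<lambda>k. c) = c" for f g c
      using p01 by (simp_all add: E_def)
    have h_eq: "h x = d\<^sup>2 * (real x - real n * p)" for x
      using n' by (simp add: h_def d2 field_simps)
    have Eh: "E h = 0"
    proof -
      have "E h = d\<^sup>2 * E (\<lambda>x. (real x - real n * p) ^ 1)" unfolding E_mult[symmetric] by (simp add: h_eq[abs_def])
      thus ?thesis using binomial_central_moments(1)[OF p01, of n] by (simp add: E_def)
    qed
    have Eh2: "E (\<lambda>x. (h x)\<^sup>2) = s\<^sup>2 * d\<^sup>2"
    proof -
      have "E (\<lambda>x. (h x)\<^sup>2) = (d\<^sup>2)\<^sup>2 * E (\<lambda>x. (real x - real n * p)\<^sup>2)"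
        unfolding E_mult[symmetric] by (simp add: h_eq power_mult_distrib)
      also have "\<dots> = (d\<^sup>2)\<^sup>2 * (real n * s\<^sup>2)"
        using binomial_central_moments(2)[OF p01, of n] s by (simp add: E_def q_def)
      also have "\<dots> = s\<^sup>2 * d\<^sup>2 * (d\<^sup>2 * real n)" by (simp add: power2_eq_square)
      also have "d\<^sup>2 * real n = 1" using n' by (simp add: d2)
      finally show ?thesis by simp
    qed
    have Eh4: "E (\<lambda>x. (h x) ^ 4) \<le> 3 * d ^ 4"
    proof -
      have "E (\<lambda>x. (h x) ^ 4) = (d\<^sup>2) ^ 4 * E (\<lambda>x. (real x - real n * p) ^ 4)"
        unfolding E_mult[symmetric] by (simp add: h_eq power_mult_distrib)
      also have "\<dots> \<le> (d\<^sup>2) ^ 4 * (3 * (real n)\<^sup>2)"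
        using binomial_central_moments(3)[OF p01, of n] by (intro mult_left_mono) (auto simp: E_def)
      also have "\<dots> = 3 * d ^ 4 * (d\<^sup>2 * real n)\<^sup>2" by (simp add: power_mult_distrib flip: power_mult power_add)
      also have "d\<^sup>2 * real n = 1" using n' by (simp add: d2)
      finally show ?thesis by simp
    qed
    define poly where "poly = (\<lambda>x. 2 * z * d * (s + G * h x - G' * (h x)\<^sup>2) + d\<^sup>2 + d ^ 3 * cf_len p z)"
    \<comment> \<open>The linear term drops out since the mean of h is 0; the concavity of the
      standard deviation survives through the variance s^2 * d^2.\<close>
    have Epoly: "E poly = 2 * z * d * (s - G' * (s\<^sup>2 * d\<^sup>2)) + d\<^sup>2 + d ^ 3 * cf_len p z"
      unfolding poly_def by (simp only: E_add E_diff E_mult E_const Eh Eh2) simp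
    have "\<bar>E (cp_length n \<alpha>) - E poly\<bar> \<le> E (\<lambda>x. C * (d ^ 4 + (h x) ^ 4))"
    proof -
      have "\<bar>E (cp_length n \<alpha>) - E poly\<bar> = \<bar>E (\<lambda>x. cp_length n \<alpha> x - poly x)\<bar>" by (simp only: E_diff)
      also have "\<dots> \<le> E (\<lambda>x. \<bar>cp_length n \<alpha> x - poly x\<bar>)"
        unfolding E_def by (rule integral_abs_bound)
      also have "\<dots> \<le> E (\<lambda>x. C * (d ^ 4 + (h x) ^ 4))"
        unfolding E_def
      proof (rule integral_mono_AE)
        show "AE x in binomial_pmf n p. \<bar>cp_length n \<alpha> x - poly x\<bar> \<le> C * (d ^ 4 + (h x) ^ 4)"
          using C(2)[OF n'(1)] assms(1,2) unfolding poly_def h_def d_def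
          by (intro AE_pmfI) (simp only: set_pmf_binomial atMost_iff)
      qed (use p01 in auto)
      finally show ?thesis .
    qed
    also have "E (\<lambda>x. C * (d ^ 4 + (h x) ^ 4)) = C * (d ^ 4 + E (\<lambda>x. (h x) ^ 4))"
      by (simp only: E_add E_mult E_const)
    also have "\<dots> \<le> C * (d ^ 4 + 3 * d ^ 4)" using Eh4 C(1) by (intro mult_left_mono) auto
    finally have main: "\<bar>E (cp_length n \<alpha>) - E poly\<bar> \<le> (4 * C) * d ^ 4" by simp
    have pw: "real n powr (-1/2) = d" "real n powr (-1) = d\<^sup>2" "real n powr (-3/2) = d ^ 3" "real n powr (-2) = d ^ 4"
    proof -
      show 1: "real n powr (-1/2) = d"
        using n' by (simp add: d_def powr_minus_divide powr_half_sqrt)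
      have *: "d ^ k = real n powr (real k * (-1/2))" for k
        unfolding 1[symmetric] using n' by (simp add: powr_power)
      show "real n powr (-1) = d\<^sup>2" "real n powr (-3/2) = d ^ 3" "real n powr (-2) = d ^ 4"
        unfolding * by simp_all
    qed
    have pq: "(p * q) powr (1/2) = s" "(p * q) powr (-1/2) = 1 / s"
      using assms(1,2) by (simp_all add: s_def q_def powr_half_sqrt powr_minus_divide)
    have pq2: "17 * p * q = 17 * s\<^sup>2" "13 * p * q * z\<^sup>2 = 13 * s\<^sup>2 * z\<^sup>2" by (simp_all add: s(2))
    \<comment> \<open>The variance correction is - 2 * z * d * s^2 * d^2 / (8 * s^3) = (z / 18) *
      (d^3 / s) * (- 9/2). Added to the constant 2 in \<open>cf_len\<close>, it produces the
      coefficient - 5/2.\<close>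
    have "E poly = 2 * z * d * s + d\<^sup>2 + d ^ 3 * (1 / s) * (z / 18) * (z\<^sup>2 - 5/2 - 17 * p * q - 13 * p * q * z\<^sup>2)"
      unfolding Epoly pq2 cf_len_def s_def[symmetric] G'_def using s(1)
      by (simp add: field_simps eval_nat_numeral)
    thus ?thesis using main unfolding pw pq E_def by simp
  qed
  thus ?thesis
    by (intro bigoI[of _ "4 * C"]) (auto simp: eventually_sequentially intro!: exI[of _ "max N 1"])
qed

end
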